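(* Let $s\in\mathbb{N}$. There is an explicitly constructed infinite sequence $\mathcal{S}_s$ of points in $[0,1)^s$, namely $\mathcal{S}_s=\mathscr{D}_5^s(\mathcal{S}_{5s})$, where $\mathcal{S}_{5s}$ is the Sobol'-type digital sequence over $\mathbb{F}_2$ in dimension $5s$ defined in the context, and there are constants $C_s,C_s'>0$ depending only on $s$, such that for all integers $N\ge 2$ $$\mathcal{L}_{2,N}(\mathcal{S}_s)\le C_s\,\frac{(\log N)^{(s-1)/2}}{N}\sqrt{S(N)}\le C_s'\,\frac{(\log N)^{s/2}}{N},$$ where $S(N)$ is the sum-of-digits function of $N$ in base $2$, i.e. if $N=2^{m_1}+2^{m_2}+\cdots+2^{m_r}$ with $m_1>m_2>\cdots>m_r\ge 0$, then $S(N)=r$.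
   Context: **Discrepancy.** For a finite family $\mathcal{P}=\{\boldsymbol{x}_0,\ldots,\boldsymbol{x}_{N-1}\}$ of points in $[0,1)^s$, let $A_N([\boldsymbol{0},\boldsymbol{t}),\mathcal{P})$ be the number of indices $n$ with $\boldsymbol{x}_n\in[0,t_1)\times\cdots\times[0,t_s)$, and let $$\mathcal{L}_{2,N}(\mathcal{P})=\left(\int_{[0,1]^s}\left|\frac{A_N([\boldsymbol{0},\boldsymbol{t}),\mathcal{P})}{N}-t_1\cdots t_s\right|^2\,d\boldsymbol{t}\right)^{1/2}.$$ For an infinite sequence $\mathcal{S}$, $\mathcal{L}_{2,N}(\mathcal{S})$ is the $\mathcal{L}_2$ discrepancy of its first $N$ elements. **Digital sequences over $\mathbb{F}_2$.** Identify $\mathbb{F}_2$ with $\{0,1\}$. Let $C_1,\ldots,C_d\in\mathbb{F}_2^{\mathbb{N}\times\mathbb{N}}$, each column of which has only finitely many nonzero entries. For $n\in\mathbb{N}_0$ with binary expansion $n=n_0+n_1 2+\cdots+n_{m-1}2^{m-1}$ put $\vec n=(n_0,\ldots,n_{m-1},0,0,\ldots)^\top$, compute $C_j\vec n=(x_{j,n,1},x_{j,n,2},\ldots)^\top$ over $\mathbb{F}_2$, and put $x_{j,n}=\sum_{i\ge1}x_{j,n,i}2^{-i}$. The digital sequence with generating matrices $C_1,\ldots,C_d$ is $(\boldsymbol{x}_0,\boldsymbol{x}_1,\ldots)$ with $\boldsymbol{x}_n=(x_{1,n},\ldots,x_{d,n})$. **Sobol'-type generating matrices in dimension $d$.** Let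 $p_1=x$ and, for $j=2,\ldots,d$, let $p_j\in\mathbb{F}_2[x]$ be the $(j-1)$th primitive polynomial in a list of all primitive polynomials over $\mathbb{F}_2$ sorted by increasing degree (the order among polynomials of equal degree is irrelevant). Let $e_j=\deg p_j$. For $j\in\{1,\ldots,d\}$ and $k\in\mathbb{N}$ write $k-1=(i-1)e_j+z$ with integers $i\ge1$, $0\le z<e_j$, and consider the Laurent expansion $$\frac{x^{e_j-z-1}}{p_j(x)^i}=\sum_{\ell=1}^\infty a_\ell(i,j,z)x^{-\ell}\in\mathbb{F}_2((x^{-1})).$$ Put $c_{j,k,\ell}=a_\ell(i,j,z)$ and $C_j=(c_{j,k,\ell})_{k,\ell\ge1}$ (one has $c_{j,k,\ell}=0$ for $k>\ell$). $\mathcal{S}_d$ denotes the digital sequence generated by $C_1,\ldots,C_d$. **Digit interlacing.** For $\alpha\in\mathbb{N}$ and $x_1,\ldots,x_\alpha\in[0,1)$ with dyadic expansions $x_r=\xi_{r,1}2^{-1}+\xi_{r,2}2^{-2}+\cdots$ (finite expansions for dyadic rationals), $\mathscr{D}_\alpha(x_1,\ldots,x_\alpha)=\sum_{a=1}^\infty\sum_{r=1}^\alpha\xi_{r,a}2^{-r-(a-1)\alpha}$. For $\boldsymbol{x}\in[0,1)^{\alpha s}$, $\mathscr{D}_\alpha^s(\boldsymbol{x})=(\mathscr{D}_\alpha(x_1,\ldots,x_\alpha),\ldots,\mathscr{D}_\alpha(x_{(s-1)\alpha+1},\ldots,x_{\alpha s}))\in[0,1)^s$. For a sequence $\mathcal{S}=(\boldsymbol{x}_0,\boldsymbol{x}_1,\ldots)$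 in $[0,1)^{\alpha s}$, $\mathscr{D}_\alpha^s(\mathcal{S})=(\mathscr{D}_\alpha^s(\boldsymbol{x}_0),\mathscr{D}_\alpha^s(\boldsymbol{x}_1),\ldots)$. *)

theory Defs
  imports
    "HOL-Library.Z2"
    "HOL-Computational_Algebra.Computational_Algebra"
    "HOL-Number_Theory.Cong"
    "HOL-Analysis.Analysis"
begin

text \<open>
  A point of dimension \<open>d\<close> is an extensional function on \<open>{1..d}\<close>, that is, an element of the
  space of \<open>Pi\<^sub>M {1..d} (\<lambda>_. lborel)\<close>.  A sequence of points is indexed from 0.
\<close>

definition count_box :: "nat \<Rightarrow> nat \<Rightarrow> (nat \<Rightarrow> nat \<Rightarrow> real) \<Rightarrow> (nat \<Rightarrow> real) \<Rightarrow> nat" where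
  "count_box s N x t = card {n. n < N \<and> (\<forall>i\<in>{1..s}. x n i \<in> {0..<t i})}"

definition L2_discrepancy :: "nat \<Rightarrow> nat \<Rightarrow> (nat \<Rightarrow> nat \<Rightarrow> real) \<Rightarrow> real" where
  "L2_discrepancy s N x =
     sqrt (LINT t : {1..s} \<rightarrow>\<^sub>E {0..1} | Pi\<^sub>M {1..s} (\<lambda>_. lborel).
             \<bar>real (count_box s N x t) / real N - (\<Prod>i=1..s. t i)\<bar>\<^sup>2)"

definition sum_of_digits2 :: "nat \<Rightarrow> nat" where
  "sum_of_digits2 N = card {m. bit N m}"

text \<open>Rows and columns of generating matrices are indexed from 1; row 0 and column 0 are unused.\<close>

type_synonym gen_matrix = "nat \<Rightarrow> nat \<Rightarrow> bit"

text \<open>Row \<open>k\<close> of the matrix-vector product; the sum is finite because digit \<open>l - 1\<close> of \<open>n\<close>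
  vanishes for \<open>l > n\<close>.\<close>

definition digital_digit :: "gen_matrix \<Rightarrow> nat \<Rightarrow> nat \<Rightarrow> bit" where
  "digital_digit C n k = (\<Sum>l=1..n. C k l * of_bool (bit n (l - 1)))"

definition digital_coord :: "gen_matrix \<Rightarrow> nat \<Rightarrow> real" where
  "digital_coord C n = (\<Sum>k. of_bool (digital_digit C n (Suc k) = 1) / 2 ^ Suc k)"

definition digital_sequence :: "nat \<Rightarrow> (nat \<Rightarrow> gen_matrix) \<Rightarrow> nat \<Rightarrow> nat \<Rightarrow> real" where
  "digital_sequence d C n = (\<lambda>j\<in>{1..d}. digital_coord (C j) n)"

text \<open>
  \<open>p\<close> is irreducible and the class of \<open>x\<close>, a root of \<open>p\<close>, generates the multiplicative group of
  the finite field of residue classes modulo \<open>p\<close>.  The second conjunct excludes \<open>p = x\<close>; the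
  polynomial \<open>x + 1\<close> is primitive.
\<close>

definition primitive_poly :: "bit poly \<Rightarrow> bool" where
  "primitive_poly p \<longleftrightarrow>
     irreducible p \<and> \<not> p dvd [:0, 1:] \<and>
     (\<forall>q. \<not> p dvd q \<longrightarrow> (\<exists>n. [q = [:0, 1:] ^ n] (mod p)))"

definition primitive_enumeration :: "(nat \<Rightarrow> bit poly) \<Rightarrow> bool" where
  "primitive_enumeration q \<longleftrightarrow>
     bij_betw q {1..} {p. primitive_poly p} \<and> mono_on {1..} (\<lambda>j. degree (q j))"

definition sobol_poly :: "(nat \<Rightarrow> bit poly) \<Rightarrow> nat \<Rightarrow> bit poly" where
  "sobol_poly q j = (if j = 1 then [:0, 1:] else q (j - 1))"

text \<open>
  Laurent series in \<open>1/x\<close> are represented by the type \<open>fls\<close> with formal variable \<open>1/x\<close>, so that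
  the polynomial variable \<open>x\<close> is mapped to \<open>fls_X_inv\<close> and the coefficient of \<open>x\<close> to the power
  \<open>-l\<close> is the \<open>l\<close>-th coefficient of the series.
\<close>

definition laurent_at_infinity :: "'a::field poly \<Rightarrow> 'a fls" where
  "laurent_at_infinity p = poly (map_poly fls_const p) fls_X_inv"

definition sobol_matrix :: "(nat \<Rightarrow> bit poly) \<Rightarrow> nat \<Rightarrow> gen_matrix" where
  "sobol_matrix q j k l =
     (let p = sobol_poly q j; e = degree p; i = (k - 1) div e + 1; z = (k - 1) mod e
      in fls_nth (laurent_at_infinity (monom 1 (e - z - 1)) / laurent_at_infinity p ^ i) (int l))"

definition sobol_sequence :: "nat \<Rightarrow> (nat \<Rightarrow> bit poly) \<Rightarrow> nat \<Rightarrow> nat \<Rightarrow> real" where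
  "sobol_sequence d q = digital_sequence d (sobol_matrix q)"

text \<open>Digit \<open>a \<ge> 1\<close> of \<open>x\<close>; this formula selects the finite expansion of dyadic rationals.\<close>

definition dyadic_digit :: "real \<Rightarrow> nat \<Rightarrow> int" where
  "dyadic_digit x a = \<lfloor>2 ^ a * x\<rfloor> mod 2"

text \<open>The summation index \<open>a\<close> is shifted to start from 0.\<close>

definition interlace :: "nat \<Rightarrow> (nat \<Rightarrow> real) \<Rightarrow> real" where
  "interlace \<alpha> x = (\<Sum>a. \<Sum>r=1..\<alpha>. real_of_int (dyadic_digit (x r) (Suc a)) / 2 ^ (r + a * \<alpha>))"

definition interlace_point :: "nat \<Rightarrow> nat \<Rightarrow> (nat \<Rightarrow> real) \<Rightarrow> nat \<Rightarrow> real" where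
  "interlace_point \<alpha> s x = (\<lambda>i\<in>{1..s}. interlace \<alpha> (\<lambda>r. x ((i - 1) * \<alpha> + r)))"

definition interlace_sequence ::
    "nat \<Rightarrow> nat \<Rightarrow> (nat \<Rightarrow> nat \<Rightarrow> real) \<Rightarrow> nat \<Rightarrow> nat \<Rightarrow> real" where
  "interlace_sequence \<alpha> s x n = interlace_point \<alpha> s (x n)"

end

theory Submission
  imports Defs
begin

text \<open>
  By Warnock's formula \<open>N\<^sup>2 L\<^sub>2\<^sup>2\<close> is a quadratic form with kernel
  \<open>\<Prod> (1 - max x\<^sub>i y\<^sub>i)\<close>.  In each coordinate this kernel is \<open>(1 - x) (1 - y)\<close> plus the
  Levy--Ciesielski expansion of \<open>min x y - x y\<close> into tent functions on dyadic intervals, so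
  \<open>N\<^sup>2 L\<^sub>2\<^sup>2\<close> is the sum over multi-levels \<open>k\<close> of the weighted squared quadrature errors
  (Haar coefficients of the discrepancy function) of products of tent functions.

  A block of \<open>2\<^sup>n\<close> consecutive indices starting at a multiple of \<open>2\<^sup>n\<close> is a shifted digital net.  A tent
  function is a constant minus a series of products of two Rademacher functions, with geometrically
  decreasing coefficients.  If \<open>|k| \<le> n - const\<close>, interlacing of order 5 makes all
  characters vanish on the block unless the total index is at least \<open>5 (n - |k|) - const\<close>; if
  \<open>|k|\<close> is larger, the boxes contain a bounded number of points.  Either way the block contributes at
  most a constant times \<open>(1/2) ^ |n - |k||\<close> at multi-level \<open>k\<close>.  Splitting \<open>{0..<N}\<close> along the binary
  digits of \<open>N\<close>, the blocks are almost orthogonal: each of the \<open>S(N)\<close> blocks contributes only at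
  the \<open>O((log N) ^ (s - 1))\<close> multi-levels with \<open>|k|\<close> near \<open>n\<close>.
\<close>

section \<open>Hat functions and the Warnock formula\<close>

text \<open>The obstacle is the range \<open>|k| < n\<close>: with \<open>d = n - |k|\<close>, a box
  of multi-level \<open>k\<close> holds about \<open>2 ^ d\<close> points of the block, yet its
  error has to decay in \<open>d\<close>. A Walsh coefficient of total index \<open>a\<close> has
  size about \<open>(1/2) ^ a\<close>, and only indices from about \<open>5 * d\<close> on survive.
  The ratio \<open>1/2\<close> is split as \<open>2/3 * 3/4\<close>: the second factor makes the sum
  over all index vectors finite, the first leaves \<open>(2/3) ^ (5 * d)\<close>, which is at most
  \<open>(1/4) ^ d\<close> and beats the growth \<open>2 ^ d\<close>. In the range
  \<open>|k| > n\<close> the decay comes from the weight of the level, at most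
  \<open>(1/2) ^ |k|\<close>, against \<open>2 ^ n\<close> points. Infinite expansions are never
  rearranged: multi-levels and Walsh indices are cut off at finite bounds, the estimates are uniform
  in the cut-off, and the limits are taken last. The sequence enters the constants only through
  \<open>s\<close> and the defect \<open>T\<close> of the net. \<open>T\<close> is governed by the
  degrees of the Sobol' polynomials, and sorting by degree makes these the same for every
  enumeration.\<close>

definition rad :: "nat \<Rightarrow> real \<Rightarrow> real" where
  "rad v y = (if odd \<lfloor>2 ^ v * y\<rfloor> then -1 else 1)"

definition tent :: "real \<Rightarrow> real" where
  "tent z = 1 - \<bar>1 - 2 * frac z\<bar>"

text \<open>The truncated subtraction gives index 0, like index 1, the single cell \<open>[0, 1)\<close>, so that the
  same formulas cover the linear function and the tents.\<close>

definition hat :: "nat \<Rightarrow> nat \<Rightarrow> real \<Rightarrow> real" where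
  "hat k m y = (if k = 0 then 1 - y
     else if \<lfloor>2 ^ (k - 1) * y\<rfloor> = int m then tent (2 ^ (k - 1) * y) else 0)"

text \<open>For \<open>k \<ge> 1\<close> this is the factor \<open>1/4\<close> of
  \<open>bridge_step\<close> times one factor \<open>1/2\<close> for each of the
  \<open>k - 1\<close> halvings that lead to the cell. Index 0 is the separate term
  \<open>(1 - x) * (1 - y)\<close>.\<close>

definition hat_weight :: "nat \<Rightarrow> real" where
  "hat_weight k = (if k = 0 then 1 else 1 / 2 ^ Suc k)"

text \<open>This is the integral of \<open>hat k m\<close> over the unit interval, for every cell
  \<open>m\<close>; the truncated subtraction gives \<open>1/2\<close>, the mean of
  \<open>1 - y\<close>, at index 0.\<close>

definition hat_mean :: "nat \<Rightarrow> real" where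
  "hat_mean k = 1 / 2 ^ Suc (k - 1)"

lemma frac_double:
  fixes z :: real
  shows "frac (2 * z) = (if frac z < 1 / 2 then 2 * frac z else 2 * frac z - 1)"
    and "\<lfloor>2 * z\<rfloor> = (if frac z < 1 / 2 then 2 * \<lfloor>z\<rfloor> else 2 * \<lfloor>z\<rfloor> + 1)"
proof -
  have z: "z = of_int \<lfloor>z\<rfloor> + frac z" by (simp add: frac_def)
  have "0 \<le> frac z" "frac z < 1" by (auto simp: frac_lt_1)
  then show fl: "\<lfloor>2 * z\<rfloor> = (if frac z < 1 / 2 then 2 * \<lfloor>z\<rfloor> else 2 * \<lfloor>z\<rfloor> + 1)"
    by (auto simp: floor_eq_iff frac_def)
  show "frac (2 * z) = (if frac z < 1 / 2 then 2 * frac z else 2 * frac z - 1)"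
    unfolding frac_def[of "2 * z"] fl by (auto simp: frac_def)
qed

lemma tent_bounds: "0 \<le> tent z" "tent z \<le> 1"
  using frac_ge_0[of z] frac_lt_1[of z] by (auto simp: tent_def abs_if)

definition bridge :: "real \<Rightarrow> real \<Rightarrow> real" where
  "bridge z w = min (frac z) (frac w) - frac z * frac w"

lemma bridge_bounds: "0 \<le> bridge z w" "bridge z w \<le> 1"
proof -
  define f g where "f = frac z" and "g = frac w"
  have *: "0 \<le> f" "f < 1" "0 \<le> g" "g < 1" by (auto simp: f_def g_def frac_lt_1)
  have "f * g \<le> f * 1" "f * g \<le> 1 * g"
    using * by (intro mult_mono; simp)+
  moreover have "0 \<le> f * g" using * by simp
  ultimately have "0 \<le> min f g - f * g" "min f g - f * g \<le> 1"
    using * unfolding min_def by (simp_all only: split: if_split) linarith+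
  then show "0 \<le> bridge z w" "bridge z w \<le> 1" by (simp_all add: bridge_def f_def g_def)
qed

text \<open>Self-similarity of the covariance of the Brownian bridge, which is the step of its
  Levy--Ciesielski expansion.\<close>

lemma bridge_step:
  assumes "\<lfloor>z\<rfloor> = \<lfloor>w\<rfloor>"
  shows "bridge z w = tent z * tent w / 4 +
    (if \<lfloor>2 * z\<rfloor> = \<lfloor>2 * w\<rfloor> then bridge (2 * z) (2 * w) / 2 else 0)"
proof -
  define f g where "f = frac z" and "g = frac w"
  have *: "0 \<le> f" "f < 1" "0 \<le> g" "g < 1" by (auto simp: f_def g_def frac_lt_1)
  have eq: "\<lfloor>2 * z\<rfloor> = \<lfloor>2 * w\<rfloor> \<longleftrightarrow> (f < 1 / 2 \<longleftrightarrow> g < 1 / 2)"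
    unfolding frac_double(2) f_def g_def using assms by simp
  have abs: "1 - \<bar>1 - 2 * h\<bar> = (if h < 1 / 2 then 2 * h else 2 - 2 * h)" for h :: real by simp
  have "f * g \<ge> 0" using * by simp
  show ?thesis
    unfolding bridge_def tent_def eq frac_double(1) f_def[symmetric] g_def[symmetric] abs
    using * by (auto simp: min_def algebra_simps add_divide_distrib diff_divide_distrib)
qed

lemma dyadic_cell:
  fixes x :: real
  assumes "0 \<le> x" "x < 1"
  shows "\<exists>a. a < 2 ^ j \<and> \<lfloor>2 ^ j * x\<rfloor> = int a"
proof -
  have "\<lfloor>2 ^ j * x\<rfloor> < 2 ^ j" "0 \<le> \<lfloor>2 ^ j * x\<rfloor>" using assms by (simp_all add: floor_less_iff)
  then obtain a where "\<lfloor>2 ^ j * x\<rfloor> = int a" "int a < int (2 ^ j)"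
    by (metis nonneg_int_cases of_nat_numeral of_nat_power)
  then show ?thesis by auto
qed

lemma hat_kernel_Suc:
  assumes "0 \<le> x" "x < 1" "0 \<le> y" "y < 1"
  shows "(\<Sum>m<2 ^ (Suc j - 1). hat (Suc j) m x * hat (Suc j) m y) =
    (if \<lfloor>2 ^ j * x\<rfloor> = \<lfloor>2 ^ j * y\<rfloor> then tent (2 ^ j * x) * tent (2 ^ j * y) else 0)"
proof -
  obtain a where a: "a < 2 ^ j" "\<lfloor>2 ^ j * x\<rfloor> = int a"
    using dyadic_cell[of x j] assms by blast
  have "(\<Sum>m<2 ^ (Suc j - 1). hat (Suc j) m x * hat (Suc j) m y) =
    (\<Sum>m<2 ^ j. if m = a then (if \<lfloor>2 ^ j * x\<rfloor> = \<lfloor>2 ^ j * y\<rfloor>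
      then tent (2 ^ j * x) * tent (2 ^ j * y) else 0) else 0)"
    by (intro sum.cong) (auto simp: hat_def a)
  also have "\<dots> = (if \<lfloor>2 ^ j * x\<rfloor> = \<lfloor>2 ^ j * y\<rfloor> then tent (2 ^ j * x) * tent (2 ^ j * y) else 0)"
    using a by (subst sum.delta) auto
  finally show ?thesis .
qed

lemma hat_sum_Suc:
  assumes "0 \<le> x" "x < 1"
  shows "(\<Sum>m<2 ^ (Suc j - 1). hat (Suc j) m x) = tent (2 ^ j * x)"
proof -
  obtain a where a: "a < 2 ^ j" "\<lfloor>2 ^ j * x\<rfloor> = int a"
    using dyadic_cell[of x j] assms by blast
  have "(\<Sum>m<2 ^ (Suc j - 1). hat (Suc j) m x) =
    (\<Sum>m<2 ^ j. if m = a then tent (2 ^ j * x) else 0)"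
    by (intro sum.cong) (auto simp: hat_def a)
  also have "\<dots> = tent (2 ^ j * x)"
    using a by (subst sum.delta) auto
  finally show ?thesis .
qed

definition hat_kernel :: "nat \<Rightarrow> real \<Rightarrow> real \<Rightarrow> real" where
  "hat_kernel J x y = (\<Sum>k\<le>J. hat_weight k * (\<Sum>m<2 ^ (k - 1). hat k m x * hat k m y))"

text \<open>This and the next definition integrate \<open>hat_kernel\<close> termwise over one
  variable and over both. Their limits are the corresponding integrals of
  \<open>1 - max x y\<close>, which are the mixed and the constant term of Warnock's
  formula.\<close>

definition hat_kernel_mean :: "nat \<Rightarrow> real \<Rightarrow> real" where
  "hat_kernel_mean J x = (\<Sum>k\<le>J. hat_weight k * (\<Sum>m<(2::nat) ^ (k - 1). hat k m x * hat_mean k))"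

definition hat_kernel_mean2 :: "nat \<Rightarrow> real" where
  "hat_kernel_mean2 J = (\<Sum>k\<le>J. hat_weight k * (\<Sum>m<(2::nat) ^ (k - 1). hat_mean k * hat_mean k))"

text \<open>Each level is one use of \<open>bridge_step\<close>. What is not yet expanded is a
  bridge covariance rescaled to the common cell of \<open>x\<close> and \<open>y\<close>, and it
  disappears once a level separates the two points.\<close>

lemma hat_kernel_remainder:
  assumes "0 \<le> x" "x < 1" "0 \<le> y" "y < 1"
  shows "1 - max x y = hat_kernel J x y +
    (if \<lfloor>2 ^ J * x\<rfloor> = \<lfloor>2 ^ J * y\<rfloor> then bridge (2 ^ J * x) (2 ^ J * y) / 2 ^ J else 0)"
proof (induction J)
  case 0
  have "\<lfloor>x\<rfloor> = 0" "\<lfloor>y\<rfloor> = 0" using assms by (auto simp: floor_eq_iff)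
  moreover have "frac x = x" "frac y = y" using assms by (simp_all add: frac_eq)
  ultimately show ?case
    by (auto simp: hat_kernel_def hat_weight_def hat_def bridge_def max_def min_def algebra_simps)
next
  case (Suc J)
  have "hat_kernel (Suc J) x y = hat_kernel J x y + hat_weight (Suc J) *
     (if \<lfloor>2 ^ J * x\<rfloor> = \<lfloor>2 ^ J * y\<rfloor> then tent (2 ^ J * x) * tent (2 ^ J * y) else 0)"
    unfolding hat_kernel_def sum.atMost_Suc hat_kernel_Suc[OF assms] ..
  moreover have "\<lfloor>2 ^ J * x\<rfloor> = \<lfloor>2 ^ J * y\<rfloor>" if "\<lfloor>2 ^ Suc J * x\<rfloor> = \<lfloor>2 ^ Suc J * y\<rfloor>"
  proof -
    have "\<lfloor>2 * (2 ^ J * x)\<rfloor> = \<lfloor>2 * (2 ^ J * y)\<rfloor>" using that by (simp add: mult.assoc)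
    then show ?thesis unfolding frac_double(2) by (simp split: if_splits)+
  qed
  moreover have "2 * (2 ^ J * x) = 2 ^ Suc J * x" "2 * (2 ^ J * y) = 2 ^ Suc J * y" by simp_all
  moreover have "hat_weight (Suc J) = 1 / (4 * 2 ^ J)" by (simp add: hat_weight_def)
  ultimately show ?case using Suc bridge_step[of "2 ^ J * x" "2 ^ J * y"]
    by (cases "\<lfloor>2 ^ J * x\<rfloor> = \<lfloor>2 ^ J * y\<rfloor>"; cases "\<lfloor>2 ^ Suc J * x\<rfloor> = \<lfloor>2 ^ Suc J * y\<rfloor>")
       (simp_all only: add_divide_distrib if_True if_False simp_thms, simp_all add: field_simps)
qed

lemma hat_kernel_tendsto:
  assumes "0 \<le> x" "x < 1" "0 \<le> y" "y < 1"
  shows "(\<lambda>J. hat_kernel J x y) \<longlonglongrightarrow> 1 - max x y"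
proof -
  have "norm (hat_kernel J x y - (1 - max x y)) \<le> (1 / 2) ^ J" for J
    unfolding hat_kernel_remainder[OF assms, of J]
    using bridge_bounds[of "2 ^ J * x" "2 ^ J * y"]
    by (auto simp: power_divide divide_right_mono)
  then have "(\<lambda>J. hat_kernel J x y - (1 - max x y)) \<longlonglongrightarrow> 0"
    by (intro Lim_null_comparison[OF _ LIMSEQ_realpow_zero[of "1 / 2"]]) simp_all
  then show ?thesis by (simp add: LIM_zero_iff)
qed

text \<open>The remainder is that of \<open>hat_kernel_remainder\<close> integrated over
  \<open>y\<close>: with \<open>t = frac (2 ^ J * x)\<close> the bridge covariance has integral
  \<open>(t - t * t) / 2\<close>, and its scale and the cell length each contribute a factor
  \<open>1 / 2 ^ J\<close>. The induction verifies this without integrals.\<close>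

lemma hat_kernel_mean_remainder:
  assumes "0 \<le> x" "x < 1"
  shows "(1 - x\<^sup>2) / 2 = hat_kernel_mean J x + (frac (2 ^ J * x) - (frac (2 ^ J * x))\<^sup>2) / (2 * 4 ^ J)"
proof (induction J)
  case 0
  have "frac x = x" using assms by (simp add: frac_eq)
  then show ?case
    by (auto simp: hat_kernel_mean_def hat_weight_def hat_mean_def hat_def field_simps power2_eq_square)
next
  case (Suc J)
  have "hat_kernel_mean (Suc J) x = hat_kernel_mean J x + hat_weight (Suc J) * hat_mean (Suc J) *
     tent (2 ^ J * x)"
    unfolding hat_kernel_mean_def sum.atMost_Suc sum_distrib_right[symmetric] hat_sum_Suc[OF assms]
    by (simp add: mult_ac)
  also have "hat_weight (Suc J) * hat_mean (Suc J) = 1 / (8 * 4 ^ J)"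
    by (simp add: hat_weight_def hat_mean_def field_simps flip: power_mult_distrib)
  finally have *: "hat_kernel_mean (Suc J) x = hat_kernel_mean J x + tent (2 ^ J * x) / (8 * 4 ^ J)"
    by simp
  have **: "frac z - (frac z)\<^sup>2 = tent z / 4 + (frac (2 * z) - (frac (2 * z))\<^sup>2) / 4" for z
    unfolding frac_double by (auto simp: tent_def abs_if field_simps power2_eq_square)
  have "2 * (2 ^ J * x) = 2 ^ Suc J * x" by simp
  then show ?case using Suc * unfolding **[of "2 ^ J * x"]
    by (simp only: add_divide_distrib) (simp add: field_simps)
qed

lemma hat_kernel_mean_tendsto:
  assumes "0 \<le> x" "x < 1"
  shows "(\<lambda>J. hat_kernel_mean J x) \<longlonglongrightarrow> (1 - x\<^sup>2) / 2"
proof -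
  have "norm (hat_kernel_mean J x - (1 - x\<^sup>2) / 2) \<le> (1 / 4) ^ J" for J
  proof -
    define t where "t = frac (2 ^ J * x)"
    have t: "0 \<le> t" "t < 1" by (auto simp: t_def frac_lt_1)
    then have "0 \<le> t * (1 - t)" "t * (1 - t) \<le> 1" by (auto intro: mult_le_one)
    then have "\<bar>t - t\<^sup>2\<bar> / (2 * 4 ^ J) \<le> 2 / (2 * 4 ^ J)"
      by (intro divide_right_mono) (auto simp: power2_eq_square algebra_simps)
    then show ?thesis
      unfolding hat_kernel_mean_remainder[OF assms, of J] t_def[symmetric]
      by (simp add: power_divide)
  qed
  then have "(\<lambda>J. hat_kernel_mean J x - (1 - x\<^sup>2) / 2) \<longlonglongrightarrow> 0"
    by (intro Lim_null_comparison[OF _ LIMSEQ_realpow_zero[of "1 / 4"]]) simp_all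
  then show ?thesis by (simp add: LIM_zero_iff)
qed

lemma hat_kernel_mean2_eq: "hat_kernel_mean2 J = 1 / 3 - 1 / (12 * 4 ^ J)"
proof (induction J)
  case 0
  show ?case by (simp add: hat_kernel_mean2_def hat_weight_def hat_mean_def)
next
  case (Suc J)
  have "hat_kernel_mean2 (Suc J) = hat_kernel_mean2 J + 1 / (16 * 4 ^ J)"
    by (simp add: hat_kernel_mean2_def hat_weight_def hat_mean_def field_simps flip: power_mult_distrib)
  then show ?case using Suc by (simp add: field_simps)
qed

lemma hat_kernel_mean2_tendsto: "hat_kernel_mean2 \<longlonglongrightarrow> 1 / 3"
proof -
  have "(\<lambda>J. 1 / 3 - 1 / 12 * (1 / 4) ^ J :: real) \<longlonglongrightarrow> 1 / 3 - 1 / 12 * 0"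
    by (intro tendsto_intros LIMSEQ_realpow_zero) auto
  then show ?thesis by (simp add: hat_kernel_mean2_eq[abs_def] power_divide)
qed

section \<open>Warnock's formula and its expansion into hat errors\<close>

lemma integral_power_Ioc:
  fixes a :: real
  assumes "a \<le> 1"
  shows "integrable lborel (\<lambda>t. indicator {a<..1} t * t ^ k)"
    and "(LINT t|lborel. indicator {a<..1} t * t ^ k) = (1 - a ^ Suc k) / Suc k"
proof -
  have ae: "AE t in lborel. indicator {a<..1} t * t ^ k = t ^ k * indicator {a..1} t"
    using AE_lborel_singleton[of a] by eventually_elim (auto simp: indicator_def)
  have int: "integrable lborel (\<lambda>t. t ^ k * indicator {a..1} t)"
    using borel_integrable_atLeastAtMost[of a 1 "\<lambda>t. t ^ k"]
    by (simp add: indicator_times_eq_if if_distrib[of "\<lambda>u. u * _"] indicator_def mult_ac cong: if_cong)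
  show "integrable lborel (\<lambda>t. indicator {a<..1} t * t ^ k)"
    using ae int by (subst integrable_cong_AE) auto
  have "(LINT t|lborel. indicator {a<..1} t * t ^ k) = (LINT t|lborel. t ^ k * indicator {a..1} t)"
    using ae by (intro integral_cong_AE) auto
  also have "\<dots> = (1 - a ^ Suc k) / Suc k"
    using integral_power[OF assms, of k] by simp
  finally show "(LINT t|lborel. indicator {a<..1} t * t ^ k) = (1 - a ^ Suc k) / Suc k" .
qed

lemma warnock:
  fixes x :: "nat \<Rightarrow> nat \<Rightarrow> real"
  assumes N: "0 < N" and x: "\<And>p i. p < N \<Longrightarrow> i \<in> {1..s} \<Longrightarrow> 0 \<le> x p i \<and> x p i < 1"
  shows "(real N * L2_discrepancy s N x)\<^sup>2 =
    (\<Sum>p<N. \<Sum>p'<N. \<Prod>i=1..s. 1 - max (x p i) (x p' i))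
    - 2 * real N * (\<Sum>p<N. \<Prod>i=1..s. (1 - (x p i)\<^sup>2) / 2) + (real N)\<^sup>2 * (\<Prod>i=1..s. 1 / 3)"
proof -
  define M where "M = Pi\<^sub>M {1..s} (\<lambda>_. lborel :: real measure)"
  interpret product_sigma_finite "\<lambda>_::nat. lborel :: real measure" by standard
  \<comment> \<open>One shape covers all terms of the expanded square: exponent 0 for pairs of
    points, 1 for a point against the volume, 2 for the squared volume. The interval is open at
    \<open>a i\<close> because a point is counted only if it is strictly below \<open>t\<close>; for
    the squared volume nothing is lost, as the integrand vanishes at 0.\<close>
  define F where "F a k t = (\<Prod>i=1..s. indicator {a i<..1} (t i) * t i ^ k :: real)"
    for a :: "nat \<Rightarrow> real" and k :: nat and t
  have F: "integrable M (F a k)" "(LINT t|M. F a k t) = (\<Prod>i=1..s. (1 - a i ^ Suc k) / Suc k)"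
    if "\<And>i. i \<in> {1..s} \<Longrightarrow> a i \<le> 1" for a k
    unfolding F_def M_def using that
    by (subst product_integrable_prod product_integral_prod; simp add: integral_power_Ioc)+
  define f where "f t = \<bar>real (count_box s N x t) / real N - (\<Prod>i=1..s. t i)\<bar>\<^sup>2" for t
  have ind: "(real N)\<^sup>2 * (indicator ({1..s} \<rightarrow>\<^sub>E {0..1}) t * f t) =
      (\<Sum>p<N. \<Sum>p'<N. F (\<lambda>i. max (x p i) (x p' i)) 0 t) - 2 * real N * (\<Sum>p<N. F (x p) 1 t)
      + (real N)\<^sup>2 * F (\<lambda>i. 0) 2 t" if t: "t \<in> space M" for t
  proof (cases "t \<in> {1..s} \<rightarrow>\<^sub>E {0..1}")
    case False
    then have "\<exists>i\<in>{1..s}. t i \<notin> {0..1}"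
      using t by (auto simp: M_def space_PiM PiE_def Pi_def)
    then obtain i where i: "i \<in> {1..s}" "t i \<notin> {0..1}" by blast
    have "F a k t = 0" if "a i \<ge> 0" for a k
      unfolding F_def using i that by (intro prod_zero finite_atLeastAtMost bexI[of _ i]) auto
    moreover have "0 \<le> max (x p i) (x p' i)" if "p < N" for p p' using x[OF that i(1)] by auto
    ultimately show ?thesis using False x i by simp
  next
    case True
    then have t': "0 \<le> t i" "t i \<le> 1" if "i \<in> {1..s}" for i
      using that by (auto simp: PiE_def Pi_def)
    define b where "b p i = (of_bool (x p i < t i) :: real)" for p i
    have "count_box s N x t = card {p\<in>{..<N}. \<forall>i\<in>{1..s}. x p i < t i}"
      unfolding count_box_def using x by (intro arg_cong[where f=card]) auto
    also have "real \<dots> = (\<Sum>p<N. of_bool (\<forall>i\<in>{1..s}. x p i < t i))"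
      by (simp add: sum.If_cases of_bool_def Int_def conj_commute)
    also have "\<dots> = (\<Sum>p<N. \<Prod>i=1..s. b p i)"
      unfolding b_def
      by (intro sum.cong refl) (force simp: of_bool_def intro!: prod.neutral[symmetric] prod_zero[symmetric])
    finally have c: "real (count_box s N x t) = (\<Sum>p<N. \<Prod>i=1..s. b p i)" .
    have "(real N)\<^sup>2 * f t = (real (count_box s N x t) - real N * (\<Prod>i=1..s. t i))\<^sup>2"
      unfolding f_def using N by (simp add: power2_eq_square field_simps)
    also have "\<dots> = (\<Sum>p<N. \<Sum>p'<N. \<Prod>i=1..s. b p i * b p' i)
        - 2 * real N * (\<Sum>p<N. \<Prod>i=1..s. b p i * t i) + (real N)\<^sup>2 * (\<Prod>i=1..s. (t i)\<^sup>2)"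
      unfolding c power2_diff
      by (simp add: power2_eq_square sum_product prod.distrib sum_distrib_left sum_distrib_right mult_ac)
    also have "(\<Sum>p<N. \<Sum>p'<N. \<Prod>i=1..s. b p i * b p' i) = (\<Sum>p<N. \<Sum>p'<N. F (\<lambda>i. max (x p i) (x p' i)) 0 t)"
      unfolding F_def b_def using t' x by (intro sum.cong prod.cong refl) (auto simp: indicator_def)
    also have "(\<Sum>p<N. \<Prod>i=1..s. b p i * t i) = (\<Sum>p<N. F (x p) 1 t)"
      unfolding F_def b_def using t' x by (intro sum.cong prod.cong refl) (auto simp: indicator_def)
    also have "(\<Prod>i=1..s. (t i)\<^sup>2) = F (\<lambda>i. 0) 2 t"
      unfolding F_def using t' by (intro prod.cong refl) (auto simp: indicator_def order_less_le)
    finally show ?thesis using True by simp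
  qed
  have a: "max (x p i) (x p' i) \<le> 1" "x p i \<le> 1" if "p < N" "p' < N" "i \<in> {1..s}" for p p' i
    using x[OF that(1,3)] x[OF that(2,3)] by auto
  have J: "integrable M (F (\<lambda>i. max (x p i) (x p' i)) 0)" "integrable M (F (x p) 1)"
    if "p < N" "p' < N" for p p'
    using a that by (auto intro!: F(1) simp del: One_nat_def)
  have I: "integrable M (\<lambda>t. \<Sum>p<N. \<Sum>p'<N. F (\<lambda>i. max (x p i) (x p' i)) 0 t)"
    "integrable M (\<lambda>t. 2 * real N * (\<Sum>p<N. F (x p) 1 t))" "integrable M (\<lambda>t. (real N)\<^sup>2 * F (\<lambda>i. 0) 2 t)"
    using J F(1)[of "\<lambda>i. 0"] by (auto intro!: Bochner_Integration.integrable_sum integrable_mult_right simp del: One_nat_def)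
  have "(real N * L2_discrepancy s N x)\<^sup>2 =
      (real N)\<^sup>2 * (LINT t|M. indicator ({1..s} \<rightarrow>\<^sub>E {0..1}) t * f t)"
    unfolding L2_discrepancy_def power_mult_distrib set_lebesgue_integral_def M_def[symmetric]
    by (subst real_sqrt_pow2) (auto simp: f_def intro!: integral_nonneg_AE)
  also have "\<dots> = (LINT t|M. (\<Sum>p<N. \<Sum>p'<N. F (\<lambda>i. max (x p i) (x p' i)) 0 t)
      - 2 * real N * (\<Sum>p<N. F (x p) 1 t) + (real N)\<^sup>2 * F (\<lambda>i. 0) 2 t)"
    unfolding integral_mult_right_zero[symmetric]
    by (intro Bochner_Integration.integral_cong refl ind)
  also have "\<dots> = (LINT t|M. (\<Sum>p<N. \<Sum>p'<N. F (\<lambda>i. max (x p i) (x p' i)) 0 t))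
      - (LINT t|M. 2 * real N * (\<Sum>p<N. F (x p) 1 t)) + (LINT t|M. (real N)\<^sup>2 * F (\<lambda>i. 0) 2 t)"
    by (simp only: Bochner_Integration.integral_add Bochner_Integration.integral_diff I Bochner_Integration.integrable_diff)
  also have "\<dots> = (\<Sum>p<N. \<Sum>p'<N. LINT t|M. F (\<lambda>i. max (x p i) (x p' i)) 0 t)
      - 2 * real N * (\<Sum>p<N. LINT t|M. F (x p) 1 t) + (real N)\<^sup>2 * (LINT t|M. F (\<lambda>i. 0) 2 t)"
    using J by (subst Bochner_Integration.integral_sum; (subst sum.cong[OF refl Bochner_Integration.integral_sum])?)
      (auto intro!: Bochner_Integration.integrable_sum simp: Bochner_Integration.integral_sum simp del: One_nat_def)
  also have "\<dots> = (\<Sum>p<N. \<Sum>p'<N. \<Prod>i=1..s. 1 - max (x p i) (x p' i))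
      - 2 * real N * (\<Sum>p<N. \<Prod>i=1..s. (1 - (x p i)\<^sup>2) / 2) + (real N)\<^sup>2 * (\<Prod>i=1..s. 1 / 3)"
  proof -
    have "(LINT t|M. F (\<lambda>i. max (x p i) (x p' i)) 0 t) = (\<Prod>i=1..s. 1 - max (x p i) (x p' i))"
      if "p < N" "p' < N" for p p'
      using a[OF that] by (subst F(2)) auto
    moreover have "(LINT t|M. F (x p) 1 t) = (\<Prod>i=1..s. (1 - (x p i)\<^sup>2) / 2)" if "p < N" for p
      using a[OF that that] by (subst F(2)) (auto simp: power2_eq_square)
    moreover have "(LINT t|M. F (\<lambda>i. 0) 2 t) = (\<Prod>i=1..s. 1 / 3)"
      by (subst F(2)) auto
    ultimately show ?thesis by simp
  qed
  finally show ?thesis .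
qed

text \<open>The error is not normalised and takes an index set \<open>P\<close>, so that it is
  additive over disjoint blocks of indices.\<close>

definition hat_error :: "nat \<Rightarrow> (nat \<Rightarrow> nat \<Rightarrow> real) \<Rightarrow> nat set \<Rightarrow> (nat \<Rightarrow> nat) \<Rightarrow> (nat \<Rightarrow> nat) \<Rightarrow> real" where
  "hat_error s x P k m =
     (\<Sum>p\<in>P. \<Prod>i=1..s. hat (k i) (m i) (x p i)) - real (card P) * (\<Prod>i=1..s. hat_mean (k i))"

definition cells :: "nat \<Rightarrow> (nat \<Rightarrow> nat) \<Rightarrow> (nat \<Rightarrow> nat) set" where
  "cells s k = (\<Pi>\<^sub>E i\<in>{1..s}. {..<2 ^ (k i - 1)})"

definition hat_energy :: "nat \<Rightarrow> (nat \<Rightarrow> nat \<Rightarrow> real) \<Rightarrow> nat set \<Rightarrow> (nat \<Rightarrow> nat) \<Rightarrow> real" where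
  "hat_energy s x P k = (\<Prod>i=1..s. hat_weight (k i)) * (\<Sum>m\<in>cells s k. (hat_error s x P k m)\<^sup>2)"

text \<open>The free \<open>g\<close> is later a product of two hats, of a hat and a mean, and of
  two means: the three terms of a squared \<open>hat_error\<close>.\<close>

lemma hat_product_expansion:
  "(\<Prod>i=1..s. \<Sum>k\<le>J. hat_weight k * (\<Sum>m<2 ^ (k - 1). g i k m)) =
   (\<Sum>k\<in>{1..s} \<rightarrow>\<^sub>E {..J}. (\<Prod>i=1..s. hat_weight (k i)) * (\<Sum>m\<in>cells s k. \<Prod>i=1..s. g i (k i) (m i)))"
  by (simp add: prod_sum_PiE prod.distrib cells_def)

lemma hat_energy_truncation:
  "(\<Sum>k\<in>{1..s} \<rightarrow>\<^sub>E {..J}. hat_energy s x {..<N} k) =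
    (\<Sum>p<N. \<Sum>p'<N. \<Prod>i=1..s. hat_kernel J (x p i) (x p' i))
    - 2 * real N * (\<Sum>p<N. \<Prod>i=1..s. hat_kernel_mean J (x p i)) + (real N)\<^sup>2 * (\<Prod>i=1..s. hat_kernel_mean2 J)"
proof -
  define S where "S = {1..s} \<rightarrow>\<^sub>E {..J}"
  define w where "w k = (\<Prod>i=1..s. hat_weight (k i))" for k
  define h where "h k m p = (\<Prod>i=1..s. hat (k i) (m i) (x p i))" for k m p
  define c where "c k = (\<Prod>i=1..s. hat_mean (k i))" for k
  have sq: "(hat_error s x {..<N} k m)\<^sup>2 = (\<Sum>p<N. \<Sum>p'<N. h k m p * h k m p')
      - 2 * real N * (\<Sum>p<N. h k m p * c k) + (real N)\<^sup>2 * (c k * c k)" for k m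
    unfolding hat_error_def h_def[symmetric] c_def[symmetric] power2_diff
    by (simp add: power2_eq_square sum_product sum_distrib_left sum_distrib_right mult_ac)
  have 1: "(\<Prod>i=1..s. hat_kernel J (x p i) (x p' i)) = (\<Sum>k\<in>S. w k * (\<Sum>m\<in>cells s k. h k m p * h k m p'))" for p p'
    unfolding hat_kernel_def hat_product_expansion S_def w_def h_def by (simp add: prod.distrib)
  have 2: "(\<Prod>i=1..s. hat_kernel_mean J (x p i)) = (\<Sum>k\<in>S. w k * (\<Sum>m\<in>cells s k. h k m p * c k))" for p
    unfolding hat_kernel_mean_def hat_product_expansion S_def w_def h_def c_def by (simp add: prod.distrib)
  have 3: "(\<Prod>i=1..s. hat_kernel_mean2 J) = (\<Sum>k\<in>S. w k * (\<Sum>m\<in>cells s k. c k * c k))"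
    unfolding hat_kernel_mean2_def hat_product_expansion S_def w_def c_def by (simp add: prod.distrib)
  have sw: "(\<Sum>p<N. \<Sum>k\<in>S. w k * (\<Sum>m\<in>cells s k. g p k m)) =
    (\<Sum>k\<in>S. w k * (\<Sum>m\<in>cells s k. \<Sum>p<N. g p k m))" for g :: "nat \<Rightarrow> _ \<Rightarrow> _ \<Rightarrow> real"
    by (subst sum.swap, intro sum.cong refl, subst sum_distrib_left[symmetric], subst sum.swap) simp
  show ?thesis
    unfolding 1 2 3 sw
    unfolding hat_energy_def sq S_def[symmetric] w_def[symmetric]
    by (simp add: sum.distrib sum_subtractf sum_distrib_left ring_distribs mult_ac)
qed

text \<open>By \<open>hat_energy_truncation\<close> each partial energy sum is Warnock's expression
  with truncated kernels. Only finitely many kernel values occur, so pointwise convergence is enough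
  and a bound uniform in \<open>J\<close> passes to the limit.\<close>

lemma discrepancy_le_hat_energy:
  assumes N: "0 < N" and x: "\<And>p i. p < N \<Longrightarrow> i \<in> {1..s} \<Longrightarrow> 0 \<le> x p i \<and> x p i < 1"
    and B: "\<And>J. (\<Sum>k\<in>{1..s} \<rightarrow>\<^sub>E {..J}. hat_energy s x {..<N} k) \<le> B"
  shows "(real N * L2_discrepancy s N x)\<^sup>2 \<le> B"
proof (rule LIMSEQ_le_const2)
  have w: "(real N * L2_discrepancy s N x)\<^sup>2 =
    (\<Sum>p<N. \<Sum>p'<N. \<Prod>i=1..s. 1 - max (x p i) (x p' i))
    - 2 * real N * (\<Sum>p<N. \<Prod>i=1..s. (1 - (x p i)\<^sup>2) / 2) + (real N)\<^sup>2 * (\<Prod>i=1..s. 1 / 3)"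
    using N x by (rule warnock)
  show "(\<lambda>J. \<Sum>k\<in>{1..s} \<rightarrow>\<^sub>E {..J}. hat_energy s x {..<N} k) \<longlonglongrightarrow> (real N * L2_discrepancy s N x)\<^sup>2"
    unfolding hat_energy_truncation w
    by (intro tendsto_intros hat_kernel_tendsto hat_kernel_mean_tendsto hat_kernel_mean2_tendsto) (use x in auto)
qed (use B in auto)

section \<open>Walsh expansion of the hat functions\<close>

lemma abs_rad [simp]: "\<bar>rad v y\<bar> = 1"
  by (simp add: rad_def)

lemma rad_0: "0 \<le> y \<Longrightarrow> y < 1 \<Longrightarrow> rad 0 y = 1"
  by (simp add: rad_def floor_eq_iff[of y 0, THEN iffD2])

lemma rad_Suc: "rad (Suc v) y = 1 - 2 * of_int (\<lfloor>2 ^ Suc v * y\<rfloor> - 2 * \<lfloor>2 ^ v * y\<rfloor>)"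
  using frac_double(2)[of "2 ^ v * y"] by (auto simp: rad_def mult.assoc)

lemma rad_add: "rad (u + v) y = rad v (2 ^ u * y)"
  by (simp add: rad_def power_add mult_ac)

text \<open>For \<open>a \<ge> 1\<close>, \<open>rad a y\<close> is 1 minus twice the binary digit
  \<open>a\<close> of \<open>y\<close>, so the series is \<open>1/2\<close> minus the dyadic
  expansion of the fractional part.\<close>

lemma rad_sums: "(\<lambda>A. \<Sum>a=1..A. rad a y / 2 ^ Suc a) \<longlonglongrightarrow> 1 / 2 - frac y"
proof -
  have eq: "(\<Sum>a=1..A. rad a y / 2 ^ Suc a) =
      1 / 2 - (1 / 2) * (1 / 2) ^ A - (of_int \<lfloor>2 ^ A * y\<rfloor> / 2 ^ A - of_int \<lfloor>y\<rfloor>)" for A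
  proof (induction A)
    case (Suc A)
    have *: "(\<Sum>a=1..Suc A. rad a y / 2 ^ Suc a) = (\<Sum>a=1..A. rad a y / 2 ^ Suc a) + rad (Suc A) y / 2 ^ Suc (Suc A)"
      by simp
    show ?case unfolding * Suc.IH rad_Suc by (simp add: field_simps)
  qed simp
  have "\<bar>of_int \<lfloor>2 ^ A * y\<rfloor> / 2 ^ A - y\<bar> \<le> (1 / 2) ^ A" for A
  proof -
    have "\<bar>of_int \<lfloor>2 ^ A * y\<rfloor> - 2 ^ A * y\<bar> \<le> 1" by linarith
    moreover have "of_int \<lfloor>2 ^ A * y\<rfloor> / 2 ^ A - y = (of_int \<lfloor>2 ^ A * y\<rfloor> - 2 ^ A * y) / 2 ^ A"
      by (simp add: diff_divide_distrib)
    ultimately show ?thesis by (simp only: abs_divide) (simp add: power_divide divide_right_mono)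
  qed
  then have "(\<lambda>A. of_int \<lfloor>2 ^ A * y\<rfloor> / 2 ^ A - y) \<longlonglongrightarrow> 0"
    by (intro Lim_null_comparison[OF _ LIMSEQ_realpow_zero[of "1 / 2"]]) simp_all
  then have l: "(\<lambda>A. of_int \<lfloor>2 ^ A * y\<rfloor> / 2 ^ A) \<longlonglongrightarrow> y" by (simp add: LIM_zero_iff)
  have "(\<lambda>A. 1 / 2 - (1 / 2) * (1 / 2) ^ A - (of_int \<lfloor>2 ^ A * y\<rfloor> / 2 ^ A - of_int \<lfloor>y\<rfloor>))
      \<longlonglongrightarrow> 1 / 2 - (1 / 2) * 0 - (y - of_int \<lfloor>y\<rfloor>)"
    by (intro tendsto_intros l LIMSEQ_realpow_zero) auto
  then show ?thesis unfolding eq by (simp add: frac_def)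
qed

definition hat_coeff :: "nat \<Rightarrow> nat \<Rightarrow> real" where
  "hat_coeff k a = (if a = 0 then 1 / 2 else (if k = 0 then 1 else -1) / 2 ^ Suc a)"

definition hat_char :: "nat \<Rightarrow> nat \<Rightarrow> real \<Rightarrow> real" where
  "hat_char k a y = (if a = 0 then 1 else rad k y * rad (k + a) y)"

definition in_cell :: "nat \<Rightarrow> nat \<Rightarrow> real \<Rightarrow> real" where
  "in_cell k m y = of_bool (\<lfloor>2 ^ (k - 1) * y\<rfloor> = int m)"

lemma abs_hat_coeff: "\<bar>hat_coeff k a\<bar> = (1 / 2) ^ Suc a"
  by (simp add: hat_coeff_def power_divide)

text \<open>The tent function has a sparse Walsh expansion: apart from the constant only products of
  two Rademacher functions occur, one of them being the leading one.\<close>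

lemma hat_expansion:
  assumes y: "0 \<le> y" "y < 1" and m: "m < 2 ^ (k - 1)"
  shows "(\<lambda>A. in_cell k m y * (\<Sum>a\<le>A. hat_coeff k a * hat_char k a y)) \<longlonglongrightarrow> hat k m y"
proof -
  \<comment> \<open>In its cell the tent equals
    \<open>1/2 - rad k y * (1/2 - frac (2 ^ k * y))\<close>: the sign tells the rising half from the
    falling one, and the bracket is expanded by \<open>rad_sums\<close>. For \<open>k = 0\<close>
    the sign is reversed because \<open>1 - y\<close> falls.\<close>
  define c :: real where "c = (if k = 0 then 1 else -1) * rad k y"
  have "(\<Sum>a\<le>A. hat_coeff k a * hat_char k a y) = 1 / 2 + c * (\<Sum>a=1..A. rad a (2 ^ k * y) / 2 ^ Suc a)" for A
  proof (induction A)
    case (Suc A)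
    have "hat_coeff k (Suc A) * hat_char k (Suc A) y = c * (rad (Suc A) (2 ^ k * y) / 2 ^ Suc (Suc A))"
      by (simp add: hat_coeff_def hat_char_def c_def rad_add[of k] del: add_Suc_right)
    then show ?case using Suc.IH by (simp add: distrib_left)
  qed (simp add: hat_coeff_def hat_char_def)
  moreover have "(\<lambda>A. in_cell k m y * (1 / 2 + c * (\<Sum>a=1..A. rad a (2 ^ k * y) / 2 ^ Suc a)))
      \<longlonglongrightarrow> in_cell k m y * (1 / 2 + c * (1 / 2 - frac (2 ^ k * y)))"
    by (intro tendsto_intros rad_sums)
  moreover have "in_cell k m y * (1 / 2 + c * (1 / 2 - frac (2 ^ k * y))) = hat k m y"
  proof (cases k)
    case 0
    then show ?thesis
      using y m by (simp add: in_cell_def c_def hat_def rad_0 frac_eq floor_eq_iff)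
  next
    case (Suc j)
    define z where "z = 2 ^ j * y"
    have z: "2 ^ k * y = 2 * z" using Suc by (simp add: z_def)
    have "c = - (if frac z < 1 / 2 then 1 else -1)"
      unfolding c_def rad_def z using Suc frac_double(2)[of z] by auto
    then have "1 / 2 + c * (1 / 2 - frac (2 ^ k * y)) = tent z"
      unfolding z frac_double(1) tent_def using frac_lt_1[of z] frac_ge_0[of z] by auto
    then show ?thesis using Suc by (simp add: in_cell_def hat_def z_def)
  qed
  ultimately show ?thesis by simp
qed

lemma hat_bounds:
  assumes y: "0 \<le> y" "y < 1" and m: "m < 2 ^ (k - 1)"
  shows "0 \<le> hat k m y" "hat k m y \<le> in_cell k m y"
  using y m tent_bounds[of "2 ^ (k - 1) * y"]
  by (cases k; auto simp: hat_def in_cell_def floor_eq_iff)+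

text \<open>Each factor is the indicator that the two numbers have the same digit
  \<open>v\<close>.\<close>

lemma rad_agree:
  assumes "0 \<le> y" "y < 1" "0 \<le> z" "z < 1"
  shows "(\<Prod>v=1..j. (rad v y * rad v z + 1) / 2) = of_bool (\<lfloor>2 ^ j * y\<rfloor> = \<lfloor>2 ^ j * z\<rfloor>)"
proof (induction j)
  case 0
  show ?case using assms by (simp add: floor_eq_iff[of _ 0, THEN iffD2])
next
  case (Suc j)
  have par: "2 * a \<noteq> 2 * b + 1" "2 * b + 1 \<noteq> 2 * a" for a b :: int
    by presburger+
  have "(\<Prod>v=1..Suc j. (rad v y * rad v z + 1) / 2) =
     (\<Prod>v=1..j. (rad v y * rad v z + 1) / 2) * ((rad (Suc j) y * rad (Suc j) z + 1) / 2)"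
    by simp
  also have "\<dots> = of_bool (\<lfloor>2 ^ j * y\<rfloor> = \<lfloor>2 ^ j * z\<rfloor>) * ((rad (Suc j) y * rad (Suc j) z + 1) / 2)"
    unfolding Suc ..
  also have "\<dots> = of_bool (\<lfloor>2 ^ Suc j * y\<rfloor> = \<lfloor>2 ^ Suc j * z\<rfloor>)"
    using frac_double(2)[of "2 ^ j * y"] frac_double(2)[of "2 ^ j * z"] par
    by (simp add: rad_Suc mult.assoc)
  finally show ?case .
qed

lemma dyadic_prefix:
  fixes y z :: real
  assumes "\<lfloor>2 ^ j * y\<rfloor> = \<lfloor>2 ^ j * z\<rfloor>" "i \<le> j"
  shows "\<lfloor>2 ^ i * y\<rfloor> = \<lfloor>2 ^ i * z\<rfloor>"
  using assms(2,1)
proof (induction rule: inc_induct)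
  case (step n)
  have "\<lfloor>2 * (2 ^ n * y)\<rfloor> = \<lfloor>2 * (2 ^ n * z)\<rfloor>" using step by (simp add: mult.assoc)
  then show ?case unfolding frac_double(2) by (simp split: if_splits)
qed simp

section \<open>Walsh functions and dyadic boxes\<close>

definition walsh :: "(nat \<times> nat) set \<Rightarrow> (nat \<Rightarrow> real) \<Rightarrow> real" where
  "walsh Z y = (\<Prod>z\<in>Z. rad (snd z) (y (fst z)))"

lemma abs_walsh: "\<bar>walsh Z y\<bar> = 1"
  by (simp add: walsh_def abs_prod)

lemma walsh_union: "finite Z \<Longrightarrow> finite Y \<Longrightarrow> Z \<inter> Y = {} \<Longrightarrow> walsh (Z \<union> Y) y = walsh Z y * walsh Y y"
  by (simp add: walsh_def prod.union_disjoint)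

definition cell_digits :: "nat \<Rightarrow> (nat \<Rightarrow> nat) \<Rightarrow> (nat \<times> nat) set" where
  "cell_digits s k = Sigma {1..s} (\<lambda>i. {1..k i - 1})"

definition in_box :: "nat \<Rightarrow> (nat \<Rightarrow> nat) \<Rightarrow> (nat \<Rightarrow> nat) \<Rightarrow> (nat \<Rightarrow> real) \<Rightarrow> real" where
  "in_box s k m y = (\<Prod>i=1..s. in_cell (k i) (m i) (y i))"

lemma finite_cell_digits [simp]: "finite (cell_digits s k)"
  by (simp add: cell_digits_def)

lemma card_cell_digits: "card (cell_digits s k) = (\<Sum>i=1..s. k i - 1)"
  by (simp add: cell_digits_def)

text \<open>The product of the digit indicators of \<open>rad_agree\<close> is multiplied out over
  subsets of \<open>cell_digits\<close>. The second Walsh factor is evaluated at the lower corner of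
  the box and is merely a sign.\<close>

lemma in_box_walsh:
  assumes y: "\<And>i. i \<in> {1..s} \<Longrightarrow> 0 \<le> y i \<and> y i < 1" and m: "m \<in> cells s k"
  shows "in_box s k m y = (1 / 2) ^ card (cell_digits s k) *
    (\<Sum>Z\<in>Pow (cell_digits s k). walsh Z y * walsh Z (\<lambda>i. real (m i) / 2 ^ (k i - 1)))"
proof -
  define z where "z i = real (m i) / 2 ^ (k i - 1)" for i
  have z: "0 \<le> z i" "z i < 1" "\<lfloor>2 ^ (k i - 1) * z i\<rfloor> = int (m i)" if "i \<in> {1..s}" for i
  proof -
    have "m i < 2 ^ (k i - 1)" using m that by (auto simp: cells_def PiE_def Pi_def)
    then have "real (m i) < 2 ^ (k i - 1)"
      by (metis of_nat_less_iff of_nat_numeral of_nat_power)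
    then show "0 \<le> z i" "z i < 1" "\<lfloor>2 ^ (k i - 1) * z i\<rfloor> = int (m i)" by (simp_all add: z_def)
  qed
  have "in_box s k m y = (\<Prod>i=1..s. \<Prod>v=1..k i - 1. (rad v (y i) * rad v (z i) + 1) / 2)"
    unfolding in_box_def in_cell_def
    by (intro prod.cong refl, subst rad_agree) (use y z in auto)
  also have "\<dots> = (\<Prod>u\<in>cell_digits s k. (rad (snd u) (y (fst u)) * rad (snd u) (z (fst u)) + 1) / 2)"
    unfolding cell_digits_def by (subst prod.Sigma) (auto intro!: prod.cong)
  also have "\<dots> = (1 / 2) ^ card (cell_digits s k) *
      (\<Prod>u\<in>cell_digits s k. rad (snd u) (y (fst u)) * rad (snd u) (z (fst u)) + 1)"
    by (simp add: prod_dividef power_divide)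
  also have "\<dots> = (1 / 2) ^ card (cell_digits s k) * (\<Sum>Z\<in>Pow (cell_digits s k). walsh Z y * walsh Z z)"
    by (subst prod_add) (simp_all add: walsh_def prod.distrib)
  finally show ?thesis by (simp add: z_def[abs_def])
qed

text \<open>Position 0, which arises when \<open>k i = 0\<close>, is dropped since
  \<open>rad 0\<close> is 1 on the unit interval. All remaining positions are at least
  \<open>k i\<close>, hence beyond those in \<open>cell_digits\<close>.\<close>

definition hat_char_digits :: "nat \<Rightarrow> (nat \<Rightarrow> nat) \<Rightarrow> (nat \<Rightarrow> nat) \<Rightarrow> (nat \<times> nat) set" where
  "hat_char_digits s k f = Sigma {1..s} (\<lambda>i. if f i = 0 then {} else {k i, k i + f i} - {0})"

lemma finite_hat_char_digits [simp]: "finite (hat_char_digits s k f)"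
  by (simp add: hat_char_digits_def)

lemma hat_char_digits_disjoint: "cell_digits s k \<inter> hat_char_digits s k f = {}"
  by (force simp: cell_digits_def hat_char_digits_def split: if_splits)

lemma prod_hat_char:
  assumes y: "\<And>i. i \<in> {1..s} \<Longrightarrow> 0 \<le> y i \<and> y i < 1"
  shows "(\<Prod>i=1..s. hat_char (k i) (f i) (y i)) = walsh (hat_char_digits s k f) y"
proof -
  have "hat_char (k i) (f i) (y i) = (\<Prod>v\<in>(if f i = 0 then {} else {k i, k i + f i} - {0}). rad v (y i))"
    if "i \<in> {1..s}" for i
  proof (cases "f i = 0 \<or> k i \<noteq> 0")
    case True
    then show ?thesis by (auto simp: hat_char_def)
  next
    case False
    then have "{k i, k i + f i} - {0} = {f i}" by auto
    then show ?thesis using False y[OF that] by (simp add: hat_char_def rad_0)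
  qed
  then have "(\<Prod>i=1..s. hat_char (k i) (f i) (y i)) =
      (\<Prod>i=1..s. \<Prod>v\<in>(if f i = 0 then {} else {k i, k i + f i} - {0}). rad v (y i))"
    by simp
  also have "\<dots> = walsh (hat_char_digits s k f) y"
    unfolding walsh_def hat_char_digits_def by (subst prod.Sigma) (auto intro!: prod.cong)
  finally show ?thesis .
qed

section \<open>Hat coefficients of binary blocks\<close>

text \<open>In \<open>independent\<close> the digits up to \<open>k i\<close> involve \<open>k i / 5\<close> rows of each of the five
  interlaced components, the digit \<open>k i + a i\<close> about \<open>a i / 5\<close> further rows of a single one; the
  condition is the resulting bound on the number of rows, multiplied by 5.\<close>

locale dyadic_net =
  fixes s T :: nat and x :: "nat \<Rightarrow> nat \<Rightarrow> real"
  assumes unit: "\<And>p i. i \<in> {1..s} \<Longrightarrow> 0 \<le> x p i \<and> x p i < 1"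
    and shift: "\<And>i v p n M. i \<in> {1..s} \<Longrightarrow> 1 \<le> v \<Longrightarrow> p < 2 ^ n \<Longrightarrow> 2 ^ n dvd M \<Longrightarrow>
      rad v (x (M + p) i) = rad v (x M i) * rad v (x p i)"
    and independent: "\<And>Z k a n. Z \<noteq> {} \<Longrightarrow>
      Z \<subseteq> {(i, v). i \<in> {1..s} \<and> 1 \<le> v \<and> (v \<le> k i \<or> v = k i + a i)} \<Longrightarrow>
      (\<Sum>i=1..s. 5 * k i + a i) + T \<le> 5 * n \<Longrightarrow> (\<Sum>p<2 ^ n. walsh Z (x p)) = 0"
begin

text \<open>By \<open>shift\<close> the value at the first index of the block factors out as a
  common sign, which leaves the block that starts at 0.\<close>

lemma sum_walsh_block:
  assumes Z: "Z \<noteq> {}" "Z \<subseteq> {(i, v). i \<in> {1..s} \<and> 1 \<le> v \<and> (v \<le> k i \<or> v = k i + a i)}"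
    and n: "(\<Sum>i=1..s. 5 * k i + a i) + T \<le> 5 * n" and M: "2 ^ n dvd M"
  shows "(\<Sum>p\<in>{M..<M + 2 ^ n}. walsh Z (x p)) = 0"
proof -
  have "(\<Sum>p\<in>{M..<M + 2 ^ n}. walsh Z (x p)) = (\<Sum>p<2 ^ n. walsh Z (x (M + p)))"
    using sum.shift_bounds_nat_ivl[of "\<lambda>p. walsh Z (x p)" 0 M "2 ^ n"]
    by (simp add: add.commute lessThan_atLeast0)
  also have "\<dots> = (\<Sum>p<2 ^ n. walsh Z (x M) * walsh Z (x p))"
    unfolding walsh_def prod.distrib[symmetric] using Z(2) M
    by (intro sum.cong prod.cong refl shift) auto
  also have "\<dots> = 0"
    unfolding sum_distrib_left[symmetric] using independent[OF Z n] by simp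
  finally show ?thesis .
qed

text \<open>After expanding the box by \<open>in_box_walsh\<close>, every term is a block sum of
  \<open>walsh (Z \<union> Y)\<close>. Such a sum vanishes unless both sets are empty, so at most
  the constant term is left.\<close>

lemma sum_in_box_walsh:
  assumes m: "m \<in> cells s k" and Y: "finite Y" "cell_digits s k \<inter> Y = {}"
      "Y \<subseteq> {(i, v). i \<in> {1..s} \<and> 1 \<le> v \<and> (v \<le> k i \<or> v = k i + a i)}"
    and n: "(\<Sum>i=1..s. 5 * k i + a i) + T \<le> 5 * n" and M: "2 ^ n dvd M"
  shows "(\<Sum>p\<in>{M..<M + 2 ^ n}. in_box s k m (x p) * walsh Y (x p)) =
    (if Y = {} then 2 ^ n / 2 ^ card (cell_digits s k) else 0)"
proof -
  let ?V = "cell_digits s k" and ?B = "{M..<M + 2 ^ n}" and ?z = "\<lambda>i. real (m i) / 2 ^ (k i - 1)"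
  have "(\<Sum>p\<in>?B. in_box s k m (x p) * walsh Y (x p)) =
      (\<Sum>p\<in>?B. (1 / 2) ^ card ?V * (\<Sum>Z\<in>Pow ?V. walsh Z ?z * walsh (Z \<union> Y) (x p)))"
  proof (intro sum.cong refl)
    fix p
    have "walsh (Z \<union> Y) (x p) = walsh Z (x p) * walsh Y (x p)" if "Z \<in> Pow ?V" for Z
      using that Y by (intro walsh_union) (auto intro: finite_subset[OF _ finite_cell_digits])
    then show "in_box s k m (x p) * walsh Y (x p) =
        (1 / 2) ^ card ?V * (\<Sum>Z\<in>Pow ?V. walsh Z ?z * walsh (Z \<union> Y) (x p))"
      using in_box_walsh[of s "x p" m k] unit m by (simp add: sum_distrib_left sum_distrib_right mult_ac)
  qed
  also have "\<dots> = (1 / 2) ^ card ?V * (\<Sum>Z\<in>Pow ?V. walsh Z ?z * (\<Sum>p\<in>?B. walsh (Z \<union> Y) (x p)))"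
    unfolding sum_distrib_left[symmetric] by (subst sum.swap) (simp add: sum_distrib_left)
  also have "(\<Sum>Z\<in>Pow ?V. walsh Z ?z * (\<Sum>p\<in>?B. walsh (Z \<union> Y) (x p))) =
      (\<Sum>Z\<in>Pow ?V. if Z = {} then if Y = {} then 2 ^ n else 0 else 0)"
  proof (intro sum.cong refl)
    fix Z assume Z: "Z \<in> Pow ?V"
    show "walsh Z ?z * (\<Sum>p\<in>?B. walsh (Z \<union> Y) (x p)) =
      (if Z = {} then if Y = {} then 2 ^ n else 0 else 0)"
    proof (cases "Z \<union> Y = {}")
      case True
      then show ?thesis by (simp add: walsh_def)
    next
      case False
      moreover have "Z \<union> Y \<subseteq> {(i, v). i \<in> {1..s} \<and> 1 \<le> v \<and> (v \<le> k i \<or> v = k i + a i)}"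
        using Z Y(3) by (force simp: cell_digits_def)
      ultimately show ?thesis using sum_walsh_block[OF _ _ n M] by auto
    qed
  qed
  also have "\<dots> = (if Y = {} then 2 ^ n else 0)"
    by (subst sum.delta) auto
  finally show ?thesis by (simp add: power_divide)
qed

lemma sum_in_box:
  assumes "m \<in> cells s k" "5 * (\<Sum>i=1..s. k i) + T \<le> 5 * n" "2 ^ n dvd M"
  shows "(\<Sum>p\<in>{M..<M + 2 ^ n}. in_box s k m (x p)) = 2 ^ n / 2 ^ card (cell_digits s k)"
  using sum_in_box_walsh[of m k "{}" "\<lambda>_. 0" n M] assms by (simp add: walsh_def sum_distrib_left)

end

lemma in_box_eq: "in_box s k m y = of_bool (\<forall>i\<in>{1..s}. \<lfloor>2 ^ (k i - 1) * y i\<rfloor> = int (m i))"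
proof (cases "\<forall>i\<in>{1..s}. \<lfloor>2 ^ (k i - 1) * y i\<rfloor> = int (m i)")
  case False
  then obtain i where "i \<in> {1..s}" "\<lfloor>2 ^ (k i - 1) * y i\<rfloor> \<noteq> int (m i)" by blast
  then have "in_box s k m y = 0"
    unfolding in_box_def in_cell_def by (intro prod_zero finite_atLeastAtMost bexI[of _ i]) auto
  then show ?thesis using False by auto
qed (auto simp: in_box_def in_cell_def)

lemma in_box_01: "in_box s k m y = 0 \<or> in_box s k m y = 1"
  unfolding in_box_eq by (simp only: of_bool_def) simp

lemma sum_geometric_PiE:
  "(\<Sum>f\<in>{1..s} \<rightarrow>\<^sub>E {..A}. (3 / 4 :: real) ^ (\<Sum>i=1..s. f i)) \<le> 4 ^ s"
proof -
  have "(\<Sum>f\<in>{1..s} \<rightarrow>\<^sub>E {..A}. (3 / 4 :: real) ^ (\<Sum>i=1..s. f i)) = (\<Prod>i=1..s. \<Sum>a\<le>A. (3 / 4) ^ a)"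
    unfolding power_sum by (subst prod_sum_PiE) auto
  also have "\<dots> \<le> (\<Prod>i=1..s. 4)"
  proof (intro prod_mono conjI sum_nonneg)
    have "(\<Sum>a\<le>A. (3 / 4 :: real) ^ a) \<le> (\<Sum>a. (3 / 4) ^ a)"
      by (intro sum_le_suminf) auto
    then show "(\<Sum>a\<le>A. (3 / 4 :: real) ^ a) \<le> 4" by (simp add: suminf_geometric)
  qed auto
  finally show ?thesis by simp
qed

context dyadic_net
begin

text \<open>The product of truncated expansions is a sum over index vectors \<open>f\<close>. The
  zero vector reproduces the mean exactly; vectors of small total index vanish by
  \<open>sum_in_box_walsh\<close>; the others have total at least the exponent \<open>R\<close> of
  \<open>2/3\<close> and are bounded by coefficient size times the number of points in the box. The
  bound does not involve \<open>A\<close>.\<close>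

lemma hat_error_truncated:
  assumes m: "m \<in> cells s k" and n: "5 * (\<Sum>i=1..s. k i) + T \<le> 5 * n" and M: "2 ^ n dvd M"
  shows "\<bar>(\<Sum>p\<in>{M..<M + 2 ^ n}. \<Prod>i=1..s. in_cell (k i) (m i) (x p i) *
       (\<Sum>a\<le>A. hat_coeff (k i) a * hat_char (k i) a (x p i))) - 2 ^ n * (\<Prod>i=1..s. hat_mean (k i))\<bar>
    \<le> 2 ^ n / 2 ^ card (cell_digits s k) * (4 ^ s * (2 / 3) ^ (5 * n - (5 * (\<Sum>i=1..s. k i) + T)))"
proof -
  let ?B = "{M..<M + 2 ^ n}" and ?S = "{1..s} \<rightarrow>\<^sub>E {..A}" and ?P = "2 ^ n / 2 ^ card (cell_digits s k) :: real"
  define R where "R = 5 * n - (5 * (\<Sum>i=1..s. k i) + T)"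
  define c where "c f = (\<Prod>i=1..s. hat_coeff (k i) (f i))" for f
  define G where "G f = (\<Sum>p\<in>?B. in_box s k m (x p) * walsh (hat_char_digits s k f) (x p))" for f
  define f0 where "f0 = (\<lambda>i\<in>{1..s}. 0 :: nat)"
  have f0: "f0 \<in> ?S" by (auto simp: f0_def)
  have fin: "finite ?S" by (intro finite_PiE) auto
  have "(\<Sum>p\<in>?B. \<Prod>i=1..s. in_cell (k i) (m i) (x p i) *
      (\<Sum>a\<le>A. hat_coeff (k i) a * hat_char (k i) a (x p i))) = (\<Sum>p\<in>?B. \<Sum>f\<in>?S. c f *
        (in_box s k m (x p) * walsh (hat_char_digits s k f) (x p)))"
  proof (intro sum.cong refl)
    fix p
    show "(\<Prod>i=1..s. in_cell (k i) (m i) (x p i) *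
      (\<Sum>a\<le>A. hat_coeff (k i) a * hat_char (k i) a (x p i))) =
      (\<Sum>f\<in>?S. c f * (in_box s k m (x p) * walsh (hat_char_digits s k f) (x p)))"
      using prod_hat_char[of s "x p" k, symmetric] unit
      by (simp add: prod.distrib prod_sum_PiE in_box_def c_def sum_distrib_left mult_ac)
  qed
  also have "\<dots> = (\<Sum>f\<in>?S. c f * G f)"
    unfolding G_def by (subst sum.swap) (simp add: sum_distrib_left)
  also have "\<dots> = c f0 * G f0 + (\<Sum>f\<in>?S - {f0}. c f * G f)"
    using f0 fin by (subst sum.remove[of _ f0]) auto
  also have "c f0 * G f0 = 2 ^ n * (\<Prod>i=1..s. hat_mean (k i))"
  proof -
    have "hat_char_digits s k f0 = {}" by (auto simp: hat_char_digits_def f0_def)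
    then have "G f0 = ?P" using sum_in_box[OF m n M] by (simp add: G_def walsh_def)
    moreover have "c f0 = (1 / 2) ^ s" by (simp add: c_def f0_def hat_coeff_def)
    moreover have "(\<Prod>i=1..s. hat_mean (k i)) = (1 / 2) ^ s / 2 ^ card (cell_digits s k)"
      unfolding card_cell_digits power_sum hat_mean_def
      by (simp add: prod_dividef prod.distrib power_divide)
    ultimately show ?thesis by simp
  qed
  finally have eq: "(\<Sum>p\<in>?B. \<Prod>i=1..s. in_cell (k i) (m i) (x p i) *
      (\<Sum>a\<le>A. hat_coeff (k i) a * hat_char (k i) a (x p i))) - 2 ^ n * (\<Prod>i=1..s. hat_mean (k i)) =
      (\<Sum>f\<in>?S - {f0}. c f * G f)" by simp
  have G: "\<bar>c f * G f\<bar> \<le> ?P * (2 / 3) ^ R * (3 / 4) ^ (\<Sum>i=1..s. f i)" if f: "f \<in> ?S - {f0}" for f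
  proof -
    have "\<exists>i\<in>{1..s}. f i \<noteq> 0"
    proof (rule ccontr)
      assume "\<not> (\<exists>i\<in>{1..s}. f i \<noteq> 0)"
      then have "f = f0" using f f0 by (intro PiE_ext[of _ "{1..s}"]) (auto simp: f0_def)
      then show False using f by simp
    qed
    then obtain i where i: "i \<in> {1..s}" "f i \<noteq> 0" by blast
    then have "(i, k i + f i) \<in> hat_char_digits s k f" by (auto simp: hat_char_digits_def)
    then have ne: "hat_char_digits s k f \<noteq> {}" by blast
    show ?thesis
    proof (cases "(\<Sum>i=1..s. 5 * k i + f i) + T \<le> 5 * n")
      case True
      have "hat_char_digits s k f \<subseteq> {(i, v). i \<in> {1..s} \<and> 1 \<le> v \<and> (v \<le> k i \<or> v = k i + f i)}"
        by (auto simp: hat_char_digits_def split: if_splits)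
      then have "G f = 0" unfolding G_def
        using sum_in_box_walsh[OF m finite_hat_char_digits hat_char_digits_disjoint _ True M] ne by simp
      then show ?thesis by simp
    next
      case False
      then have R: "R \<le> (\<Sum>i=1..s. f i)" by (simp add: R_def sum.distrib sum_distrib_left)
      have "\<bar>G f\<bar> \<le> (\<Sum>p\<in>?B. in_box s k m (x p))"
        unfolding G_def
      proof (rule order.trans[OF sum_abs], intro sum_mono)
        fix p show "\<bar>in_box s k m (x p) * walsh (hat_char_digits s k f) (x p)\<bar> \<le> in_box s k m (x p)"
          using in_box_01[of s k m "x p"] by (auto simp: abs_mult abs_walsh)
      qed
      then have "\<bar>G f\<bar> \<le> ?P" using sum_in_box[OF m n M] by simp
      moreover have "\<bar>c f\<bar> \<le> (1 / 2) ^ (\<Sum>i=1..s. f i)"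
        unfolding c_def abs_prod power_sum by (intro prod_mono) (auto simp: abs_hat_coeff)
      ultimately have "\<bar>c f * G f\<bar> \<le> (1 / 2) ^ (\<Sum>i=1..s. f i) * ?P"
        unfolding abs_mult by (intro mult_mono) auto
      \<comment> \<open>one factor supplies the decay in \<open>R\<close>, the other keeps the sum over \<open>f\<close> convergent\<close>
      also have "(1 / 2 :: real) ^ (\<Sum>i=1..s. f i) = (2 / 3) ^ (\<Sum>i=1..s. f i) * (3 / 4) ^ (\<Sum>i=1..s. f i)"
        unfolding power_mult_distrib[symmetric] by simp
      also have "\<dots> * ?P \<le> ((2 / 3) ^ R * (3 / 4) ^ (\<Sum>i=1..s. f i)) * ?P"
        by (intro mult_right_mono power_decreasing R) auto
      finally show ?thesis by (simp add: mult_ac)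
    qed
  qed
  have "\<bar>\<Sum>f\<in>?S - {f0}. c f * G f\<bar> \<le> (\<Sum>f\<in>?S - {f0}. ?P * (2 / 3) ^ R * (3 / 4) ^ (\<Sum>i=1..s. f i))"
    by (rule order.trans[OF sum_abs]) (intro sum_mono G)
  also have "\<dots> \<le> (\<Sum>f\<in>?S. ?P * (2 / 3) ^ R * (3 / 4) ^ (\<Sum>i=1..s. f i))"
    using fin by (intro sum_mono2) auto
  also have "\<dots> = ?P * (2 / 3) ^ R * (\<Sum>f\<in>?S. (3 / 4) ^ (\<Sum>i=1..s. f i))"
    by (simp add: sum_distrib_left)
  also have "\<dots> \<le> ?P * (2 / 3) ^ R * 4 ^ s"
    by (intro mult_left_mono sum_geometric_PiE) auto
  finally show ?thesis unfolding eq R_def by (simp add: mult_ac)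
qed

lemma hat_error_fine:
  assumes m: "m \<in> cells s k" and n: "5 * (\<Sum>i=1..s. k i) + T \<le> 5 * n" and M: "2 ^ n dvd M"
  shows "\<bar>hat_error s x {M..<M + 2 ^ n} k m\<bar>
    \<le> 2 ^ n / 2 ^ card (cell_digits s k) * (4 ^ s * (2 / 3) ^ (5 * n - (5 * (\<Sum>i=1..s. k i) + T)))"
proof (rule LIMSEQ_le_const2)
  have m': "m i < 2 ^ (k i - 1)" if "i \<in> {1..s}" for i
    using m that by (auto simp: cells_def PiE_def Pi_def)
  show "(\<lambda>A. \<bar>(\<Sum>p\<in>{M..<M + 2 ^ n}. \<Prod>i=1..s. in_cell (k i) (m i) (x p i) *
       (\<Sum>a\<le>A. hat_coeff (k i) a * hat_char (k i) a (x p i))) - 2 ^ n * (\<Prod>i=1..s. hat_mean (k i))\<bar>)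
     \<longlonglongrightarrow> \<bar>hat_error s x {M..<M + 2 ^ n} k m\<bar>"
    unfolding hat_error_def using unit m' by (simp, intro tendsto_intros hat_expansion) auto
qed (use hat_error_truncated[OF assms] in auto)

end

section \<open>Energy of a single block\<close>

definition level_distance :: "nat \<Rightarrow> nat \<Rightarrow> nat" where
  "level_distance n l = (n - l) + (l - n)"

lemma prod_hat_weight_le: "(\<Prod>i=1..s. hat_weight (k i)) \<le> 1 / 2 ^ (\<Sum>i=1..s. k i)"
proof -
  have "(\<Prod>i=1..s. hat_weight (k i)) \<le> (\<Prod>i=1..s. 1 / 2 ^ k i)"
    by (intro prod_mono) (auto simp: hat_weight_def field_simps)
  then show ?thesis by (simp add: prod_dividef power_sum)
qed

lemma hat_weight_nonneg: "0 \<le> hat_weight k"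
  by (simp add: hat_weight_def)

lemma sum_le_card_cell_digits: "(\<Sum>i=1..s. k i) \<le> card (cell_digits s k) + s"
proof -
  have "(\<Sum>i=1..s. k i) \<le> (\<Sum>i=1..s. (k i - 1) + 1)" by (intro sum_mono) auto
  then show ?thesis unfolding card_cell_digits sum.distrib by simp
qed

lemma card_cells: "card (cells s k) = 2 ^ card (cell_digits s k)"
  unfolding cells_def card_cell_digits power_sum by (simp add: card_PiE)

lemma finite_cells [simp]: "finite (cells s k)"
  by (auto simp: cells_def intro!: finite_PiE)

lemma sum_in_box_cells:
  assumes "\<And>i. i \<in> {1..s} \<Longrightarrow> 0 \<le> y i \<and> y i < 1"
  shows "(\<Sum>m\<in>cells s k. in_box s k m y) = 1"
proof -
  have "(\<Sum>m<2 ^ (k i - 1). in_cell (k i) m (y i)) = 1" if i: "i \<in> {1..s}" for i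
  proof -
    obtain a where a: "a < 2 ^ (k i - 1)" "\<lfloor>2 ^ (k i - 1) * y i\<rfloor> = int a"
      using dyadic_cell[of "y i" "k i - 1"] assms[OF i] by blast
    have "(\<Sum>m<2 ^ (k i - 1). in_cell (k i) m (y i)) = (\<Sum>m<2 ^ (k i - 1). if a = m then 1 else 0)"
      unfolding in_cell_def a(2) by (intro sum.cong) auto
    then show ?thesis using a by simp
  qed
  then show ?thesis unfolding in_box_def cells_def by (subst prod_sum_PiE[symmetric]) auto
qed

lemma exists_le_with_sum:
  fixes k :: "nat \<Rightarrow> nat"
  assumes "K \<le> (\<Sum>i=1..s. k i)"
  shows "\<exists>l. (\<forall>i. l i \<le> k i) \<and> (\<Sum>i=1..s. l i) = K"
  using assms
proof (induction "(\<Sum>i=1..s. k i) - K" arbitrary: K)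
  case (Suc d)
  then obtain l where l: "\<forall>i. l i \<le> k i" "(\<Sum>i=1..s. l i) = Suc K"
    by (metis Suc_diff_Suc Suc_leI diff_Suc_1 zero_less_Suc zero_less_diff)
  then obtain j where j: "j \<in> {1..s}" "l j \<noteq> 0" by (metis nat.distinct(1) sum.neutral)
  have "(\<Sum>i=1..s. (l(j := l j - 1)) i) + 1 = (\<Sum>i=1..s. l i)"
    using j by (simp add: sum.remove[of "{1..s}" j, OF finite_atLeastAtMost j(1)] del: One_nat_def)
  then have "(\<Sum>i=1..s. (l(j := l j - 1)) i) = K" using l by simp
  moreover have "\<forall>i. (l(j := l j - 1)) i \<le> k i" using l by (auto simp: le_diff_conv intro: order.trans)
  ultimately show ?case by blast
qed auto

context dyadic_net
begin

text \<open>The box is too fine for the net property, so it is enlarged: if it contains a point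
  \<open>x q\<close>, it lies in the box around \<open>x q\<close> of a coarser multi-level
  \<open>l\<close> with total exactly \<open>n - T\<close>, where \<open>sum_in_box\<close> gives
  the exact count. If \<open>n < T\<close>, the whole block is small enough.\<close>

lemma count_in_box_le:
  assumes m: "m \<in> cells s k" and k: "5 * n < 5 * (\<Sum>i=1..s. k i) + T" and M: "2 ^ n dvd M"
  shows "(\<Sum>p\<in>{M..<M + 2 ^ n}. in_box s k m (x p)) \<le> 2 ^ (s + T)"
proof (cases "n < T \<or> (\<forall>p\<in>{M..<M + 2 ^ n}. in_box s k m (x p) = 0)")
  case True
  then show ?thesis
  proof
    assume "n < T"
    have "(\<Sum>p\<in>{M..<M + 2 ^ n}. in_box s k m (x p)) \<le> (\<Sum>p\<in>{M..<M + 2 ^ n}. 1)"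
      using in_box_01 by (intro sum_mono) (metis order.refl zero_le_one)
    also have "\<dots> = 2 ^ n" by simp
    also have "\<dots> \<le> 2 ^ (s + T)" using \<open>n < T\<close> by (intro power_increasing) auto
    finally show ?thesis .
  qed simp
next
  case False
  then obtain q where q: "in_box s k m (x q) = 1" "T \<le> n" using in_box_01 by force
  have "n - T \<le> (\<Sum>i=1..s. k i)" using k q(2) by arith
  then obtain l where l: "\<forall>i. l i \<le> k i" "(\<Sum>i=1..s. l i) = n - T"
    using exists_le_with_sum by blast
  define m' where "m' = (\<lambda>i\<in>{1..s}. nat \<lfloor>2 ^ (l i - 1) * x q i\<rfloor>)"
  have m'i: "m' i < 2 ^ (l i - 1)" "int (m' i) = \<lfloor>2 ^ (l i - 1) * x q i\<rfloor>" if i: "i \<in> {1..s}" for i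
  proof -
    obtain a where "a < 2 ^ (l i - 1)" "\<lfloor>2 ^ (l i - 1) * x q i\<rfloor> = int a"
      using dyadic_cell[of "x q i" "l i - 1"] unit[OF i, of q] by blast
    then show "m' i < 2 ^ (l i - 1)" "int (m' i) = \<lfloor>2 ^ (l i - 1) * x q i\<rfloor>" using i by (auto simp: m'_def)
  qed
  then have m': "m' \<in> cells s l" by (auto simp: cells_def m'_def)
  have "in_box s k m (x p) \<le> in_box s l m' (x p)" for p
  proof (cases "in_box s k m (x p) = 1")
    case True
    have "\<lfloor>2 ^ (l i - 1) * x p i\<rfloor> = int (m' i)" if i: "i \<in> {1..s}" for i
    proof -
      have "\<lfloor>2 ^ (k i - 1) * x p i\<rfloor> = \<lfloor>2 ^ (k i - 1) * x q i\<rfloor>"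
        using True q i by (auto simp: in_box_eq split: if_splits)
      then show ?thesis unfolding m'i(2)[OF i] by (rule dyadic_prefix) (simp add: diff_le_mono l)
    qed
    then show ?thesis using True by (simp add: in_box_eq)
  next
    case False
    then show ?thesis using in_box_01 by (metis order.refl zero_le_one)
  qed
  then have "(\<Sum>p\<in>{M..<M + 2 ^ n}. in_box s k m (x p)) \<le> (\<Sum>p\<in>{M..<M + 2 ^ n}. in_box s l m' (x p))"
    by (intro sum_mono)
  also have "\<dots> = 2 ^ n / 2 ^ card (cell_digits s l)"
    using q(2) l(2) by (intro sum_in_box m' M) auto
  also have "\<dots> \<le> 2 ^ (s + T)"
  proof -
    have "n \<le> s + T + card (cell_digits s l)" using sum_le_card_cell_digits[of l s] l(2) q(2) by auto
    then have "(2::real) ^ n \<le> 2 ^ (s + T + card (cell_digits s l))" by (intro power_increasing) auto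
    then show ?thesis by (simp add: power_add divide_le_eq)
  qed
  finally show ?thesis .
qed

text \<open>Sum and mean are both nonnegative, so the squared difference is at most the sum of the
  squares. One factor of the squared count is bounded by \<open>count_in_box_le\<close>; the other
  sums to \<open>2 ^ n\<close>, since the boxes partition the cube.\<close>

lemma hat_error_coarse:
  assumes M: "2 ^ n dvd M" and k: "5 * n < 5 * (\<Sum>i=1..s. k i) + T"
  shows "(\<Sum>m\<in>cells s k. (hat_error s x {M..<M + 2 ^ n} k m)\<^sup>2) \<le>
    2 ^ (s + T) * 2 ^ n + (2 ^ n)\<^sup>2 / 2 ^ card (cell_digits s k)"
proof -
  let ?B = "{M..<M + 2 ^ n}"
  let ?V = "2 ^ card (cell_digits s k) :: real"
  define c where "c m = (\<Sum>p\<in>?B. in_box s k m (x p))" for m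
  have "(hat_error s x ?B k m)\<^sup>2 \<le> 2 ^ (s + T) * c m + (2 ^ n / ?V)\<^sup>2" if m: "m \<in> cells s k" for m
  proof -
    have m': "m i < 2 ^ (k i - 1)" if "i \<in> {1..s}" for i
      using m that by (auto simp: cells_def PiE_def Pi_def)
    define a where "a = (\<Sum>p\<in>?B. \<Prod>i=1..s. hat (k i) (m i) (x p i))"
    define b where "b = 2 ^ n * (\<Prod>i=1..s. hat_mean (k i))"
    have a: "0 \<le> a" "a \<le> c m"
      unfolding a_def c_def in_box_def using hat_bounds unit m'
      by (auto intro!: sum_nonneg prod_nonneg sum_mono prod_mono)
    have "(\<Prod>i=1..s. hat_mean (k i)) \<le> (\<Prod>i=1..s. 1 / 2 ^ (k i - 1))"
      by (intro prod_mono) (auto simp: hat_mean_def field_simps)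
    also have "\<dots> = 1 / ?V" by (simp add: prod_dividef power_sum card_cell_digits)
    finally have b: "0 \<le> b" "b \<le> 2 ^ n / ?V"
      by (auto simp: b_def hat_mean_def intro!: prod_nonneg mult_nonneg_nonneg dest: mult_left_mono[where c="2 ^ n"])
    have "(hat_error s x ?B k m)\<^sup>2 = (a - b)\<^sup>2" by (simp add: hat_error_def a_def b_def)
    also have "\<dots> \<le> a\<^sup>2 + b\<^sup>2" using a b by (simp add: power2_diff)
    also have "\<dots> \<le> (c m)\<^sup>2 + (2 ^ n / ?V)\<^sup>2" using a b by (intro add_mono power_mono) auto
    also have "(c m)\<^sup>2 \<le> 2 ^ (s + T) * c m"
      unfolding power2_eq_square using a count_in_box_le[OF m k M, folded c_def]
      by (intro mult_right_mono) auto
    finally show ?thesis by simp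
  qed
  then have "(\<Sum>m\<in>cells s k. (hat_error s x ?B k m)\<^sup>2) \<le>
      (\<Sum>m\<in>cells s k. 2 ^ (s + T) * c m + (2 ^ n / ?V)\<^sup>2)" by (intro sum_mono)
  also have "\<dots> = 2 ^ (s + T) * (\<Sum>m\<in>cells s k. c m) + ?V * (2 ^ n / ?V)\<^sup>2"
    by (simp add: sum.distrib sum_distrib_left card_cells)
  also have "(\<Sum>m\<in>cells s k. c m) = 2 ^ n"
    unfolding c_def by (subst sum.swap) (subst sum_in_box_cells, use unit in auto)
  also have "?V * (2 ^ n / ?V)\<^sup>2 = (2 ^ n)\<^sup>2 / ?V" by (simp add: power2_eq_square)
  finally show ?thesis .
qed

text \<open>\<open>64 ^ s\<close> is the square of the factor \<open>8 ^ s\<close> in the error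
  bound for fine blocks. \<open>8 ^ T\<close> dominates \<open>(9 / 4) ^ T\<close> there and equals
  the \<open>2 ^ T * 4 ^ T\<close> of the other case.\<close>

definition block_constant :: real where
  "block_constant = 2 * 64 ^ s * 8 ^ T"

lemma hat_energy_block:
  assumes M: "2 ^ n dvd M"
  shows "hat_energy s x {M..<M + 2 ^ n} k \<le> block_constant * (1 / 2) ^ level_distance n (\<Sum>i=1..s. k i)"
proof -
  let ?V = "card (cell_digits s k)" and ?E = "hat_error s x {M..<M + 2 ^ n} k"
  define K where "K = (\<Sum>i=1..s. k i)"
  have V: "K \<le> ?V + s" using sum_le_card_cell_digits K_def by simp
  have V': "?V \<le> K" unfolding K_def card_cell_digits by (intro sum_mono) auto
  have w: "hat_energy s x {M..<M + 2 ^ n} k \<le> 1 / 2 ^ K * (\<Sum>m\<in>cells s k. (?E m)\<^sup>2)"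
    unfolding hat_energy_def K_def by (intro mult_right_mono prod_hat_weight_le sum_nonneg) auto
  show ?thesis
  proof (cases "5 * K + T \<le> 5 * n")
    case True
    define d where "d = n - K"
    have n: "n = K + d" "T \<le> 5 * d" using True by (auto simp: d_def)
    have "(2 / 3 :: real) ^ (5 * n - (5 * K + T)) * (2 / 3) ^ T = (2 / 3) ^ (5 * d)"
      using n by (subst power_add[symmetric]) (auto simp: algebra_simps)
    also have "\<dots> = ((2 / 3) ^ 5) ^ d" by (rule power_mult)
    \<comment> \<open>\<open>(2 / 3) ^ 5 = 32 / 243\<close> is below \<open>1/4\<close>. Here the
      interlacing order pays for the roughly \<open>2 ^ d\<close> points per box and still leaves a
      factor \<open>(1 / 2) ^ d\<close>.\<close>
    also have "\<dots> \<le> (1 / 4) ^ d" by (intro power_mono) (auto simp: eval_nat_numeral)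
    finally have r: "(2 / 3 :: real) ^ (5 * n - (5 * K + T)) \<le> (1 / 4) ^ d * (3 / 2) ^ T"
      by (simp add: field_simps)
    have "(2::real) ^ n \<le> 2 ^ (d + s + ?V)" using n V by (intro power_increasing) auto
    then have q: "(2::real) ^ n / 2 ^ ?V \<le> 2 ^ d * 2 ^ s" by (simp add: power_add divide_le_eq)
    have "\<bar>?E m\<bar> \<le> 8 ^ s * (3 / 2) ^ T * (1 / 2) ^ d" if "m \<in> cells s k" for m
    proof -
      have "\<bar>?E m\<bar> \<le> 2 ^ n / 2 ^ ?V * (4 ^ s * (2 / 3) ^ (5 * n - (5 * K + T)))"
        unfolding K_def using True that M by (intro hat_error_fine) (auto simp: K_def)
      also have "\<dots> \<le> (2 ^ d * 2 ^ s) * (4 ^ s * ((1 / 4) ^ d * (3 / 2) ^ T))"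
        using q r by (intro mult_mono) auto
      also have "\<dots> = (2 * 4) ^ s * (3 / 2) ^ T * (2 * (1 / 4)) ^ d"
        unfolding power_mult_distrib by (simp only: mult_ac)
      finally show ?thesis by simp
    qed
    then have "(?E m)\<^sup>2 \<le> (8 ^ s * (3 / 2) ^ T * (1 / 2) ^ d)\<^sup>2" if "m \<in> cells s k" for m
      using that by (metis abs_ge_zero power2_abs power_mono)
    then have "(\<Sum>m\<in>cells s k. (?E m)\<^sup>2) \<le> 2 ^ ?V * (8 ^ s * (3 / 2) ^ T * (1 / 2) ^ d)\<^sup>2"
      using sum_bounded_above[of "cells s k" "\<lambda>m. (?E m)\<^sup>2"] by (simp add: card_cells)
    also have "\<dots> \<le> 2 ^ K * (8 ^ s * (3 / 2) ^ T * (1 / 2) ^ d)\<^sup>2"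
      using V' by (intro mult_right_mono power_increasing) auto
    finally have "(\<Sum>m\<in>cells s k. (?E m)\<^sup>2) \<le> 2 ^ K * (8 ^ s * (3 / 2) ^ T * (1 / 2) ^ d)\<^sup>2" .
    moreover have sq: "(a ^ j)\<^sup>2 = (a\<^sup>2) ^ j" for a :: real and j
      by (simp add: power_mult[symmetric] mult.commute)
    moreover have "(8 ^ s * (3 / 2 :: real) ^ T * (1 / 2) ^ d)\<^sup>2 = 64 ^ s * (9 / 4) ^ T * (1 / 4) ^ d"
      unfolding power_mult_distrib sq by (simp add: power2_eq_square)
    ultimately have "1 / 2 ^ K * (\<Sum>m\<in>cells s k. (?E m)\<^sup>2) \<le> 64 ^ s * (9 / 4) ^ T * (1 / 4) ^ d"
      by (simp add: field_simps)
    also have "\<dots> \<le> (2 * 64 ^ s) * 8 ^ T * (1 / 2) ^ d"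
      by (intro mult_mono power_mono) auto
    finally show ?thesis using w n
      unfolding block_constant_def level_distance_def K_def[symmetric] by simp
  next
    case False
    define r :: real where "r = 2 ^ n / 2 ^ K"
    have "(2::real) ^ n \<le> 2 ^ (K + T)" using False by (intro power_increasing) auto
    then have r: "0 \<le> r" "r \<le> 2 ^ T" by (auto simp: r_def power_add divide_le_eq mult.commute)
    have "1 / 2 ^ K * (\<Sum>m\<in>cells s k. (?E m)\<^sup>2) \<le> 1 / 2 ^ K * (2 ^ (s + T) * 2 ^ n + (2 ^ n)\<^sup>2 / 2 ^ ?V)"
      using False by (intro mult_left_mono hat_error_coarse[OF M]) (auto simp: K_def)
    also have "\<dots> \<le> 1 / 2 ^ K * (2 ^ (s + T) * 2 ^ n + (2 ^ n)\<^sup>2 * (2 ^ s / 2 ^ K))"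
    proof -
      have "(2::real) ^ K \<le> 2 ^ (s + ?V)" using V by (intro power_increasing) auto
      then have "1 / (2::real) ^ ?V \<le> 2 ^ s / 2 ^ K" by (simp add: power_add field_simps)
      from mult_left_mono[OF this, of "(2 ^ n)\<^sup>2"] show ?thesis by (simp add: divide_right_mono)
    qed
    also have "\<dots> = 2 ^ (s + T) * r + 2 ^ s * r * r"
      by (simp add: r_def field_simps power2_eq_square)
    also have "\<dots> \<le> 2 ^ (s + T) * r + 2 ^ s * r * 2 ^ T"
      using r by (intro add_left_mono mult_left_mono) auto
    also have "\<dots> = 2 * 2 ^ s * 2 ^ T * r" by (simp add: power_add)
    also have "\<dots> \<le> 2 * 2 ^ s * 2 ^ T * (4 ^ T * (1 / 2) ^ level_distance n K)"
    proof (intro mult_left_mono)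
      show "r \<le> 4 ^ T * (1 / 2) ^ level_distance n K"
      proof (cases "n \<le> K")
        case True
        have "r = (1 / 2) ^ (K - n)"
          unfolding r_def using power_add[of "2::real" n "K - n"] True by (simp add: power_divide)
        moreover have "(1::real) \<le> 4 ^ T" by simp
        ultimately show ?thesis using True mult_right_mono[of 1 "4 ^ T" r] r
          by (simp add: level_distance_def)
      next
        case nK: False
        have "r = 2 ^ (n - K)"
          unfolding r_def using power_add[of "2::real" K "n - K"] nK by simp
        \<comment> \<open>In this intermediate range \<open>n - K \<le> T\<close>, so turning the
          growth \<open>2 ^ (n - K)\<close> into decay costs at most the factor
          \<open>4 ^ T\<close>.\<close>
        moreover have "(2::real) ^ (n - K) * 2 ^ (n - K) \<le> 2 ^ T * 2 ^ T"
          using False nK by (intro mult_mono power_increasing) auto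
        ultimately show ?thesis using nK
          by (simp add: level_distance_def field_simps flip: power_mult_distrib)
      qed
    qed auto
    also have "\<dots> = 2 * 2 ^ s * 8 ^ T * (1 / 2) ^ level_distance n K"
      by (simp flip: power_mult_distrib mult.assoc)
    also have "\<dots> \<le> 2 * 64 ^ s * 8 ^ T * (1 / 2) ^ level_distance n K"
      by (intro mult_right_mono mult_left_mono power_mono) auto
    finally show ?thesis using w unfolding block_constant_def K_def[symmetric] by simp
  qed
qed

end

section \<open>Splitting along binary digits and counting multi-levels\<close>

lemma sum_binary_blocks:
  fixes f :: "nat \<Rightarrow> 'a::comm_monoid_add"
  shows "(\<Sum>p<N. f p) =
    (\<Sum>n | bit N n. \<Sum>p\<in>{2 ^ Suc n * (N div 2 ^ Suc n)..<2 ^ Suc n * (N div 2 ^ Suc n) + 2 ^ n}. f p)"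
proof -
  \<comment> \<open>\<open>P n\<close> is \<open>N\<close> with its lowest \<open>n\<close> digits
    cleared. The block of digit \<open>n\<close> starts at \<open>P (Suc n)\<close>, a multiple of
    \<open>2 ^ Suc n\<close>, and ends at \<open>P n\<close>.\<close>
  define P where "P n = 2 ^ n * (N div 2 ^ n)" for n
  define b where "b n = (if bit N n then \<Sum>p\<in>{P (Suc n)..<P (Suc n) + 2 ^ n}. f p else 0)" for n
  have step: "P n = P (Suc n) + (if bit N n then 2 ^ n else 0)" for n
  proof -
    define u where "u = N div 2 ^ n"
    have "2 * (u div 2) + (if odd u then 1 else 0) = u" by presburger
    then have "2 ^ n * u = 2 ^ n * (2 * (u div 2) + (if odd u then 1 else 0))" by (simp only:)
    also have "\<dots> = 2 ^ Suc n * (u div 2) + (if odd u then 2 ^ n else 0)"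
      by (simp add: distrib_left)
    also have "u div 2 = N div 2 ^ Suc n" by (simp only: u_def power_Suc2 div_mult2_eq)
    also have "odd u = bit N n" by (simp add: u_def bit_iff_odd)
    finally show ?thesis by (simp only: P_def u_def)
  qed
  have rec: "(\<Sum>p<P n. f p) = (\<Sum>p<P (Suc n). f p) + b n" for n
  proof (cases "bit N n")
    case True
    then have "P n = P (Suc n) + 2 ^ n" using step[of n] by simp
    then show ?thesis
      using True sum.atLeastLessThan_concat[of 0 "P (Suc n)" "P n" f] by (simp add: b_def lessThan_atLeast0)
  next
    case False
    then show ?thesis using step[of n] by (simp add: b_def)
  qed
  have "(\<Sum>p<P 0. f p) = (\<Sum>p<P n. f p) + (\<Sum>j<n. b j)" for n
  proof (induction n)
    case (Suc n)
    show ?case unfolding Suc rec[of n] by (simp add: add_ac)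
  qed simp
  from this[of N] have "(\<Sum>p<N. f p) = (\<Sum>j<N. b j)"
    by (simp add: P_def)
  also have "\<dots> = (\<Sum>n\<in>{n \<in> {..<N}. bit N n}. \<Sum>p\<in>{P (Suc n)..<P (Suc n) + 2 ^ n}. f p)"
    unfolding b_def by (rule sum.inter_filter[symmetric]) simp
  also have "{n \<in> {..<N}. bit N n} = {n. bit N n}"
  proof -
    have "n < N" if "bit N n" for n
    proof (rule ccontr)
      assume "\<not> n < N"
      then have "N < 2 ^ n" by (meson le_less_trans less_exp not_less)
      then show False using that by (simp add: bit_iff_odd)
    qed
    then show ?thesis by auto
  qed
  finally show ?thesis by (simp only: P_def)
qed

lemma bit_nat_bounds:
  fixes N :: nat
  shows "bit N n \<Longrightarrow> 2 ^ n \<le> N" and "finite {n. bit N n}"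
proof -
  show le: "2 ^ n \<le> N" if "bit N n" for n
    using that by (metis bit_iff_odd div_less even_zero not_less)
  have "n \<le> N" if "bit N n" for n
    using le[OF that] less_exp[of n] by linarith
  then have "{n. bit N n} \<subseteq> {..N}" by auto
  then show "finite {n. bit N n}" by (rule finite_subset) simp
qed

text \<open>Each distance is attained at most once with \<open>n \<le> l\<close> and at most once
  with \<open>n > l\<close>, hence the factor 2.\<close>

lemma sum_level_distance_le:
  fixes g :: "nat \<Rightarrow> real"
  assumes g: "summable g" "\<And>d. 0 \<le> g d" and B: "finite B"
  shows "(\<Sum>n\<in>B. g (level_distance n l)) \<le> 2 * suminf g"
proof -
  have *: "(\<Sum>n\<in>C. g (level_distance n l)) \<le> suminf g"
    if "finite C" "inj_on (\<lambda>n. level_distance n l) C" for C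
  proof -
    have "(\<Sum>n\<in>C. g (level_distance n l)) = sum g ((\<lambda>n. level_distance n l) ` C)"
      using that by (simp add: sum.reindex)
    also have "\<dots> \<le> suminf g" using that g by (intro sum_le_suminf) auto
    finally show ?thesis .
  qed
  have "(\<Sum>n\<in>B. g (level_distance n l)) =
      (\<Sum>n\<in>B \<inter> {..l}. g (level_distance n l)) + (\<Sum>n\<in>B - {..l}. g (level_distance n l))"
    using B by (rule sum.Int_Diff)
  also have "\<dots> \<le> suminf g + suminf g"
    using B by (intro add_mono *) (auto simp: inj_on_def level_distance_def)
  finally show ?thesis by simp
qed

text \<open>The first component is determined by the others, each of which is at most
  \<open>l\<close>. This lost degree of freedom is the origin of the exponent \<open>s - 1\<close>
  of the logarithm.\<close>

lemma card_PiE_sum_eq: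
  fixes J l s :: nat
  assumes "1 \<le> s"
  shows "card {k \<in> {1..s} \<rightarrow>\<^sub>E {..J}. (\<Sum>i=1..s. k i) = l} \<le> (l + 1) ^ (s - 1)"
proof -
  let ?A = "{k \<in> {1..s} \<rightarrow>\<^sub>E {..J}. (\<Sum>i=1..s. k i) = l}"
  have s: "{1..s} = insert 1 {2..s}" using assms by auto
  have "inj_on (\<lambda>k. restrict k {2..s}) ?A"
  proof (rule inj_onI)
    fix k k' assume k: "k \<in> ?A" "k' \<in> ?A" and eq: "restrict k {2..s} = restrict k' {2..s}"
    then have e: "k i = k' i" if "i \<in> {2..s}" for i using that by (metis restrict_apply')
    have "k 1 + (\<Sum>i\<in>{2..s}. k i) = k' 1 + (\<Sum>i\<in>{2..s}. k' i)"
      using k unfolding s by simp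
    then have "k 1 = k' 1" using e by simp
    then show "k = k'" using k e s by (intro PiE_ext[of k "{1..s}" "\<lambda>_. {..J}" k']) auto
  qed
  moreover have "(\<lambda>k. restrict k {2..s}) ` ?A \<subseteq> {2..s} \<rightarrow>\<^sub>E {..l}"
  proof (rule image_subsetI)
    fix k assume k: "k \<in> ?A"
    have "k i \<le> l" if "i \<in> {2..s}" for i
      using member_le_sum[of i "{1..s}" k] k that by simp
    then show "restrict k {2..s} \<in> {2..s} \<rightarrow>\<^sub>E {..l}" by auto
  qed
  ultimately have "card ?A \<le> card ({2..s} \<rightarrow>\<^sub>E {..l})"
    by (rule card_inj_on_le) (intro finite_PiE; simp)
  then show ?thesis by (simp add: card_PiE)
qed

lemma sum_PiE_level_le:
  fixes g :: "nat \<Rightarrow> real"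
  assumes "1 \<le> s" and g: "\<And>l. 0 \<le> g l"
  shows "(\<Sum>k\<in>{1..s} \<rightarrow>\<^sub>E {..J}. g (\<Sum>i=1..s. k i)) \<le> (\<Sum>l\<le>s * J. real (l + 1) ^ (s - 1) * g l)"
proof -
  let ?S = "{1..s} \<rightarrow>\<^sub>E {..J}" and ?f = "\<lambda>k. \<Sum>i=1..s. k i :: nat"
  have fin: "finite ?S" by (intro finite_PiE) auto
  have "?f ` ?S \<subseteq> {..s * J}"
    using sum_bounded_above[of "{1..s}" _ J] by (force simp: PiE_def Pi_def)
  then have "(\<Sum>k\<in>?S. g (?f k)) = (\<Sum>l\<le>s * J. \<Sum>k\<in>{k \<in> ?S. ?f k = l}. g (?f k))"
    using fin by (intro sum.group[symmetric]) auto
  also have "\<dots> = (\<Sum>l\<le>s * J. real (card {k \<in> ?S. ?f k = l}) * g l)"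
    by (intro sum.cong refl) simp
  also have "\<dots> \<le> (\<Sum>l\<le>s * J. real ((l + 1) ^ (s - 1)) * g l)"
    using card_PiE_sum_eq[OF assms(1), of J] g by (intro sum_mono mult_right_mono of_nat_mono) auto
  finally show ?thesis by simp
qed

lemma weighted_Cauchy_Schwarz:
  fixes w E :: "'a \<Rightarrow> real"
  assumes "\<And>n. n \<in> B \<Longrightarrow> 0 < w n"
  shows "(\<Sum>n\<in>B. E n)\<^sup>2 \<le> (\<Sum>n\<in>B. w n) * (\<Sum>n\<in>B. (E n)\<^sup>2 / w n)"
proof -
  have "(\<Sum>n\<in>B. sqrt (w n) * (E n / sqrt (w n)))\<^sup>2 \<le> (\<Sum>n\<in>B. (sqrt (w n))\<^sup>2) * (\<Sum>n\<in>B. (E n / sqrt (w n))\<^sup>2)"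
    by (rule Cauchy_Schwarz_ineq_sum)
  also have "(\<Sum>n\<in>B. sqrt (w n) * (E n / sqrt (w n))) = (\<Sum>n\<in>B. E n)"
    by (intro sum.cong refl) (use assms in fastforce)
  also have "(\<Sum>n\<in>B. (sqrt (w n))\<^sup>2) = (\<Sum>n\<in>B. w n)"
    by (intro sum.cong refl) (use assms in \<open>auto simp: less_imp_le\<close>)
  also have "(\<Sum>n\<in>B. (E n / sqrt (w n))\<^sup>2) = (\<Sum>n\<in>B. (E n)\<^sup>2 / w n)"
    by (intro sum.cong refl) (use assms in \<open>auto simp: power_divide less_imp_le\<close>)
  finally show ?thesis .
qed

definition level_constant :: "nat \<Rightarrow> real" where
  "level_constant s = (\<Sum>d. real (d + 1) ^ (s - 1) * (2 / 3) ^ d)"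

lemma summable_level: "summable (\<lambda>d. real (d + 1) ^ r * (2 / 3) ^ d)"
proof -
  have "(\<lambda>d. (1 + 1 / real (Suc d)) ^ r) \<longlonglongrightarrow> (1 + 0) ^ r"
    by (intro tendsto_intros LIMSEQ_Suc[OF lim_1_over_n])
  then have "\<forall>\<^sub>F d in sequentially. (1 + 1 / real (Suc d)) ^ r < 5 / 4"
    by (rule order_tendstoD) simp
  then obtain D where D: "\<And>d. D \<le> d \<Longrightarrow> (1 + 1 / real (Suc d)) ^ r < 5 / 4"
    unfolding eventually_sequentially by blast
  show ?thesis
  \<comment> \<open>From \<open>D\<close> on the polynomial factor grows by less than
    \<open>5/4\<close> per step, and \<open>5/4 * 2/3 = 5/6\<close>.\<close>
  proof (rule summable_ratio_test[of "5 / 6" D])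
    fix d assume "D \<le> d"
    have "real (Suc d + 1) = real (d + 1) * (1 + 1 / real (Suc d))" by (simp add: field_simps)
    then have "real (Suc d + 1) ^ r = real (d + 1) ^ r * (1 + 1 / real (Suc d)) ^ r"
      by (simp only: power_mult_distrib)
    also have "\<dots> \<le> real (d + 1) ^ r * (5 / 4)"
      using D[OF \<open>D \<le> d\<close>] by (intro mult_left_mono) auto
    finally have "real (Suc d + 1) ^ r * (2 / 3) ^ Suc d \<le> (real (d + 1) ^ r * (5 / 4)) * (2 / 3) ^ Suc d"
      by (intro mult_right_mono) auto
    then show "norm (real (Suc d + 1) ^ r * (2 / 3) ^ Suc d) \<le> 5 / 6 * norm (real (d + 1) ^ r * (2 / 3) ^ d)"
      by simp
  qed simp
qed

context dyadic_net
begin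

text \<open>Weighting the block of size \<open>2\<^sup>n\<close> by \<open>(3 / 4) ^ |n - |k||\<close>, between 1 and the decay of its energy,
  makes the cross terms summable at the cost of a worse ratio.\<close>

lemma hat_energy_le:
  "hat_energy s x {..<N} k \<le>
     8 * block_constant * (\<Sum>n | bit N n. (2 / 3) ^ level_distance n (\<Sum>i=1..s. k i))"
proof -
  define M where "M n = 2 ^ Suc n * (N div 2 ^ Suc n)" for n
  define B where "B n = {M n..<M n + 2 ^ n}" for n
  define K where "K = (\<Sum>i=1..s. k i)"
  define w :: "nat \<Rightarrow> real" where "w n = (3 / 4) ^ level_distance n K" for n
  let ?N = "{n. bit N n}"
  have M: "2 ^ n dvd M n" for n by (simp add: M_def)
  have w: "0 < w n" for n by (simp add: w_def)
  have e: "hat_error s x P k m = (\<Sum>p\<in>P. (\<Prod>i=1..s. hat (k i) (m i) (x p i)) - (\<Prod>i=1..s. hat_mean (k i)))"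
    for P m by (simp add: hat_error_def sum_subtractf)
  have split: "hat_error s x {..<N} k m = (\<Sum>n\<in>?N. hat_error s x (B n) k m)" for m
    unfolding e B_def M_def by (rule sum_binary_blocks)
  have W: "(\<Sum>n\<in>?N. w n) \<le> 8"
  proof -
    have "(\<Sum>n\<in>?N. w n) \<le> 2 * (\<Sum>d. (3 / 4 :: real) ^ d)"
      unfolding w_def by (intro sum_level_distance_le bit_nat_bounds) auto
    then show ?thesis by (simp add: suminf_geometric)
  qed
  have c: "0 \<le> block_constant" by (simp add: block_constant_def)
  have "hat_energy s x {..<N} k \<le>
      (\<Prod>i=1..s. hat_weight (k i)) * (\<Sum>m\<in>cells s k. 8 * (\<Sum>n\<in>?N. (hat_error s x (B n) k m)\<^sup>2 / w n))"
    unfolding hat_energy_def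
  proof (intro mult_left_mono sum_mono prod_nonneg hat_weight_nonneg ballI)
    fix m
    have "(hat_error s x {..<N} k m)\<^sup>2 \<le> (\<Sum>n\<in>?N. w n) * (\<Sum>n\<in>?N. (hat_error s x (B n) k m)\<^sup>2 / w n)"
      unfolding split using w by (intro weighted_Cauchy_Schwarz) auto
    also have "\<dots> \<le> 8 * (\<Sum>n\<in>?N. (hat_error s x (B n) k m)\<^sup>2 / w n)"
      using W w by (intro mult_right_mono sum_nonneg) (auto simp: less_imp_le)
    finally show "(hat_error s x {..<N} k m)\<^sup>2 \<le> 8 * (\<Sum>n\<in>?N. (hat_error s x (B n) k m)\<^sup>2 / w n)" .
  qed
  also have "\<dots> = 8 * (\<Sum>n\<in>?N. hat_energy s x (B n) k / w n)"
    unfolding hat_energy_def sum_distrib_left sum_divide_distrib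
    by (subst sum.swap, intro sum.cong refl) simp
  also have "\<dots> \<le> 8 * (\<Sum>n\<in>?N. block_constant * (2 / 3) ^ level_distance n K)"
  proof (intro mult_left_mono sum_mono)
    fix n
    have "hat_energy s x (B n) k \<le> block_constant * (1 / 2) ^ level_distance n K"
      unfolding B_def K_def by (rule hat_energy_block[OF M])
    also have "(1 / 2 :: real) ^ level_distance n K = (2 / 3) ^ level_distance n K * w n"
      unfolding w_def power_mult_distrib[symmetric] by simp
    finally show "hat_energy s x (B n) k / w n \<le> block_constant * (2 / 3) ^ level_distance n K"
      using w[of n] by (simp add: pos_divide_le_eq mult.assoc)
  qed simp
  finally show ?thesis by (simp add: sum_distrib_left K_def mult_ac)
qed

text \<open>With the order of summation exchanged, each digit of \<open>N\<close> is charged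
  separately: its energy is concentrated near total level \<open>n\<close>, where at most about
  \<open>(n + 1) ^ (s - 1)\<close> multi-levels lie. The bound is uniform in \<open>J\<close>, as
  \<open>discrepancy_le_hat_energy\<close> requires.\<close>

lemma sum_hat_energy_le:
  assumes s: "1 \<le> s"
  shows "(\<Sum>k\<in>{1..s} \<rightarrow>\<^sub>E {..J}. hat_energy s x {..<N} k) \<le>
    16 * block_constant * level_constant s * (\<Sum>n | bit N n. real (n + 1) ^ (s - 1))"
proof -
  define g where "g n l = (2 / 3 :: real) ^ level_distance n l" for n l
  define h where "h d = real (d + 1) ^ (s - 1) * (2 / 3 :: real) ^ d" for d
  let ?N = "{n. bit N n}" and ?S = "{1..s} \<rightarrow>\<^sub>E {..J}"
  have c: "0 \<le> block_constant" by (simp add: block_constant_def)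
  have "(\<Sum>k\<in>?S. hat_energy s x {..<N} k) \<le> (\<Sum>k\<in>?S. 8 * block_constant * (\<Sum>n\<in>?N. g n (\<Sum>i=1..s. k i)))"
    unfolding g_def by (intro sum_mono hat_energy_le)
  also have "\<dots> = 8 * block_constant * (\<Sum>n\<in>?N. \<Sum>k\<in>?S. g n (\<Sum>i=1..s. k i))"
    unfolding sum_distrib_left[symmetric] by (subst sum.swap) (rule refl)
  also have "\<dots> \<le> 8 * block_constant * (\<Sum>n\<in>?N. real (n + 1) ^ (s - 1) * (2 * suminf h))"
  proof (intro mult_left_mono sum_mono)
    fix n
    have "(\<Sum>k\<in>?S. g n (\<Sum>i=1..s. k i)) \<le> (\<Sum>l\<le>s * J. real (l + 1) ^ (s - 1) * g n l)"
      by (intro sum_PiE_level_le[OF s]) (simp add: g_def)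
    also have "\<dots> \<le> (\<Sum>l\<le>s * J. real (n + 1) ^ (s - 1) * h (level_distance l n))"
    proof (intro sum_mono)
      fix l
      have d: "level_distance l n = level_distance n l" by (simp add: level_distance_def)
      \<comment> \<open>This inequality separates \<open>n\<close> from the distance, so that the
        polynomial in the distance is absorbed by the geometric decay in \<open>h\<close>.\<close>
      have "l + 1 \<le> (n + 1) * (level_distance n l + 1)" by (simp add: level_distance_def)
      then have "real (l + 1) \<le> real (n + 1) * real (level_distance n l + 1)"
        unfolding of_nat_mult[symmetric] of_nat_le_iff .
      then have "real (l + 1) ^ (s - 1) \<le> (real (n + 1) * real (level_distance n l + 1)) ^ (s - 1)"
        by (rule power_mono) simp
      then show "real (l + 1) ^ (s - 1) * g n l \<le> real (n + 1) ^ (s - 1) * h (level_distance l n)"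
        unfolding power_mult_distrib h_def g_def d mult.assoc[symmetric] by (rule mult_right_mono) simp
    qed
    also have "\<dots> = real (n + 1) ^ (s - 1) * (\<Sum>l\<le>s * J. h (level_distance l n))"
      by (simp add: sum_distrib_left)
    also have "\<dots> \<le> real (n + 1) ^ (s - 1) * (2 * suminf h)"
      unfolding h_def by (intro mult_left_mono sum_level_distance_le summable_level) auto
    finally show "(\<Sum>k\<in>?S. g n (\<Sum>i=1..s. k i)) \<le> real (n + 1) ^ (s - 1) * (2 * suminf h)" .
  qed (use c in auto)
  also have "suminf h = level_constant s" by (simp only: h_def[abs_def] level_constant_def)
  finally show ?thesis by (simp add: sum_distrib_left sum_distrib_right mult_ac)
qed

end

section \<open>Linear independence of the generating matrices\<close>

lemma laurent_at_infinity_pCons: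
  "laurent_at_infinity (pCons a p) = fls_const a + fls_X_inv * laurent_at_infinity p"
  by (simp add: laurent_at_infinity_def map_poly_pCons)

lemma laurent_at_infinity_0 [simp]: "laurent_at_infinity 0 = 0"
  by (simp add: laurent_at_infinity_def)

lemma laurent_at_infinity_1 [simp]: "laurent_at_infinity 1 = 1"
  by (simp add: laurent_at_infinity_pCons one_pCons)

lemma laurent_at_infinity_add:
  "laurent_at_infinity (p + q) = laurent_at_infinity p + laurent_at_infinity q"
proof -
  have "map_poly fls_const (p + q) = map_poly fls_const p + map_poly fls_const q"
    by (rule poly_eqI) (simp add: coeff_map_poly fls_plus_const)
  then show ?thesis by (simp add: laurent_at_infinity_def)
qed

lemma laurent_at_infinity_smult:
  "laurent_at_infinity (smult a p) = fls_const a * laurent_at_infinity p"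
  by (induction p) (simp_all add: laurent_at_infinity_pCons algebra_simps)

lemma laurent_at_infinity_mult:
  "laurent_at_infinity (p * q) = laurent_at_infinity p * laurent_at_infinity q"
  by (induction p) (simp_all add: laurent_at_infinity_pCons laurent_at_infinity_add
      laurent_at_infinity_smult algebra_simps)

lemma laurent_at_infinity_power: "laurent_at_infinity (p ^ n) = laurent_at_infinity p ^ n"
  by (induction n) (simp_all add: laurent_at_infinity_mult)

lemma laurent_at_infinity_sum:
  "laurent_at_infinity (\<Sum>i\<in>A. f i) = (\<Sum>i\<in>A. laurent_at_infinity (f i))"
  by (induction A rule: infinite_finite_induct) (simp_all add: laurent_at_infinity_add)

lemma laurent_at_infinity_nth:
  "fls_nth (laurent_at_infinity p) l = (if l \<le> 0 then coeff p (nat (- l)) else 0)"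
proof (induction p arbitrary: l)
  case (pCons a p)
  have "nat (- l) = Suc (nat (- (l + 1)))" if "l < 0" using that by simp
  then show ?case
    by (auto simp: laurent_at_infinity_pCons fls_X_inv_times_conv_shift pCons.IH coeff_pCons)
qed simp

lemma laurent_at_infinity_eq_0_iff [simp]: "laurent_at_infinity p = 0 \<longleftrightarrow> p = 0"
proof
  assume *: "laurent_at_infinity p = 0"
  show "p = 0"
  proof (rule poly_eqI)
    fix n show "coeff p n = coeff 0 n"
      using laurent_at_infinity_nth[of p "- int n"] * by simp
  qed
qed simp

lemma fls_subdegree_laurent_at_infinity:
  assumes "p \<noteq> 0"
  shows "fls_subdegree (laurent_at_infinity p) = - int (degree p)"
  by (rule fls_subdegree_eqI) (use assms in \<open>auto simp: laurent_at_infinity_nth coeff_eq_0\<close>)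

definition laurent_row :: "'a::field poly \<Rightarrow> nat \<Rightarrow> 'a fls" where
  "laurent_row p k = laurent_at_infinity (monom 1 (degree p - (k - 1) mod degree p - 1)) /
     laurent_at_infinity p ^ ((k - 1) div degree p + 1)"

lemma sobol_matrix_eq: "sobol_matrix q j k l = fls_nth (laurent_row (sobol_poly q j) k) (int l)"
  by (simp add: sobol_matrix_def laurent_row_def Let_def)

lemma row_index:
  fixes e k :: nat
  assumes "0 < e" "1 \<le> k"
  shows "((k - 1) div e + 1) * e = k + (e - (k - 1) mod e - 1)" "(k - 1) mod e < e"
proof -
  have "(k - 1) div e * e + (k - 1) mod e = k - 1" by simp
  moreover show "(k - 1) mod e < e" using assms by simp
  ultimately show "((k - 1) div e + 1) * e = k + (e - (k - 1) mod e - 1)"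
    unfolding add_mult_distrib using assms by linarith
qed

text \<open>By \<open>row_index\<close> the degree of the denominator exceeds that of the numerator
  by exactly \<open>k\<close>. This is the triangular shape of the generating matrices.\<close>

lemma laurent_row_subdegree:
  assumes "0 < degree p" "1 \<le> k"
  shows "laurent_row p k \<noteq> 0" "fls_subdegree (laurent_row p k) = int k"
proof -
  define e z i where "e = degree p" and "z = (k - 1) mod e" and "i = (k - 1) div e + 1"
  let ?m = "monom 1 (e - z - 1) :: 'a poly" and ?L = "laurent_at_infinity p ^ i"
  have p: "p \<noteq> 0" using assms by auto
  have row: "laurent_row p k = laurent_at_infinity ?m / ?L" by (simp add: laurent_row_def e_def z_def i_def)
  show nz: "laurent_row p k \<noteq> 0" unfolding row using p by (simp add: monom_eq_0_iff)
  have "laurent_row p k * ?L = laurent_at_infinity ?m" unfolding row using p by simp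
  then have "fls_subdegree (laurent_row p k * ?L) = - int (e - z - 1)"
    using fls_subdegree_laurent_at_infinity[of ?m] by (simp add: monom_eq_0_iff degree_monom_eq)
  moreover have "fls_subdegree ?L = - int (i * e)"
    using p by (simp add: fls_subdegree_pow fls_subdegree_laurent_at_infinity e_def)
  ultimately have "fls_subdegree (laurent_row p k) = int (i * e) - int (e - z - 1)"
    using nz p by simp
  also have "i * e = k + (e - z - 1)" using row_index(1)[of e k] assms by (simp add: e_def z_def i_def)
  finally show "fls_subdegree (laurent_row p k) = int k" by simp
qed

text \<open>The numerator of row \<open>k\<close> over the common denominator \<open>p ^ Q\<close>.
  For fixed \<open>Q\<close> its degree is \<open>Q * degree p - k\<close>, so numerators of
  different rows have different degrees.\<close>

definition row_numerator :: "'a::field poly \<Rightarrow> nat \<Rightarrow> nat \<Rightarrow> 'a poly" where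
  "row_numerator p Q k = monom 1 (degree p - (k - 1) mod degree p - 1) * p ^ (Q - ((k - 1) div degree p + 1))"

lemma row_numerator:
  assumes p: "0 < degree p" and k: "1 \<le> k" and Q: "(k - 1) div degree p + 1 \<le> Q"
  shows "laurent_row p k * laurent_at_infinity p ^ Q = laurent_at_infinity (row_numerator p Q k)"
    and "row_numerator p Q k \<noteq> 0" and "degree (row_numerator p Q k) + k = Q * degree p"
proof -
  define e z i where "e = degree p" and "z = (k - 1) mod e" and "i = (k - 1) div e + 1"
  have p0: "p \<noteq> 0" using p by auto
  have iQ: "i \<le> Q" using Q by (simp only: i_def e_def)
  have num: "row_numerator p Q k = monom 1 (e - z - 1) * p ^ (Q - i)"
    by (simp add: row_numerator_def e_def z_def i_def)
  have "laurent_at_infinity p ^ Q = laurent_at_infinity p ^ i * laurent_at_infinity p ^ (Q - i)"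
    using iQ by (simp flip: power_add)
  then show "laurent_row p k * laurent_at_infinity p ^ Q = laurent_at_infinity (row_numerator p Q k)"
    unfolding num laurent_at_infinity_mult laurent_at_infinity_power
    using p0 by (simp add: laurent_row_def e_def z_def i_def)
  show "row_numerator p Q k \<noteq> 0" unfolding num using p0 by (simp add: monom_eq_0_iff)
  have "degree (row_numerator p Q k) = (e - z - 1) + (Q - i) * e"
    unfolding num using p0
    by (simp add: degree_mult_eq degree_power_eq monom_eq_0_iff degree_monom_eq e_def)
  moreover have "i * e = k + (e - z - 1)" using row_index(1)[of e k] p k by (simp add: e_def z_def i_def)
  moreover have "Q * e = i * e + (Q - i) * e"
    using iQ by (simp flip: distrib_right)
  ultimately show "degree (row_numerator p Q k) + k = Q * degree p" by (simp add: e_def)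
qed

lemma prime_elem_not_dvd_prod:
  fixes p :: "'a::comm_semiring_1"
  assumes "prime_elem p" "\<And>i. i \<in> A \<Longrightarrow> \<not> p dvd f i"
  shows "\<not> p dvd prod f A"
  using assms(2)
  by (induction A rule: infinite_finite_induct)
     (auto simp: prime_elem_dvd_mult_iff[OF assms(1)] prime_elem_not_unit[OF assms(1)])

text \<open>Clearing denominators turns a relation between the first \<open>n\<close> columns into a relation
  between polynomials of degree less than the common denominator, and such a relation contradicts
  the uniqueness of partial fractions.\<close>

lemma laurent_rows_independent:
  fixes P :: "nat \<Rightarrow> bit poly"
  assumes J: "finite J" and irr: "\<And>j. j \<in> J \<Longrightarrow> irreducible (P j)"
    and ndvd: "\<And>i j. i \<in> J \<Longrightarrow> j \<in> J \<Longrightarrow> i \<noteq> j \<Longrightarrow> \<not> P i dvd P j"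
    and Z: "Z \<subseteq> {(j, k). j \<in> J \<and> 1 \<le> k \<and> k \<le> D j}"
    and n: "(\<Sum>j\<in>J. D j + degree (P j)) \<le> n"
    and zero: "\<And>l. 1 \<le> l \<Longrightarrow> l \<le> n \<Longrightarrow> (\<Sum>z\<in>Z. fls_nth (laurent_row (P (fst z)) (snd z)) (int l)) = 0"
  shows "Z = {}"
proof (rule ccontr)
  assume "Z \<noteq> {}"
  then obtain j0 k0 where jk0: "(j0, k0) \<in> Z" by auto
  \<comment> \<open>This exponent clears all rows up to \<open>D j\<close>, while
    \<open>Q j * degree (P j)\<close> stays within \<open>D j + degree (P j)\<close>, the amount
    budgeted in the hypothesis on \<open>n\<close>.\<close>
  define Q where "Q j = D j div degree (P j) + 1" for j
  define N where "N j k = row_numerator (P j) (Q j) k" for j k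
  define G where "G j = (\<Prod>l\<in>J - {j}. P l ^ Q l)" for j
  define g where "g = (\<Prod>j\<in>J. P j ^ Q j)"
  define L where "L = (\<Sum>z\<in>Z. laurent_row (P (fst z)) (snd z))"
  define H where "H = (\<Sum>z\<in>Z. N (fst z) (snd z) * G (fst z))"
  have deg: "0 < degree (P j)" if "j \<in> J" for j
    using irr[OF that] by (metis irreducible_def not_gr_zero is_unit_iff_degree)
  have P0: "P j \<noteq> 0" if "j \<in> J" for j using deg[OF that] by auto
  have "Z \<subseteq> Sigma J (\<lambda>j. {1..D j})" using Z by auto
  then have finZ: "finite Z" by (rule finite_subset) (use J in auto)
  have gG: "g = P j ^ Q j * G j" if "j \<in> J" for j
    unfolding g_def G_def using J that by (rule prod.remove)
  have Qk: "(k - 1) div degree (P j) + 1 \<le> Q j" if "(j, k) \<in> Z" for j k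
  proof -
    have "k - 1 \<le> D j" using Z that by auto
    then show ?thesis unfolding Q_def by (simp add: div_le_mono)
  qed
  have num: "laurent_row (P j) k * laurent_at_infinity (P j) ^ Q j = laurent_at_infinity (N j k)"
    "N j k \<noteq> 0" "degree (N j k) + k = Q j * degree (P j)" if "(j, k) \<in> Z" for j k
  proof -
    have "j \<in> J" "1 \<le> k" using Z that by auto
    then show "laurent_row (P j) k * laurent_at_infinity (P j) ^ Q j = laurent_at_infinity (N j k)"
      "N j k \<noteq> 0" "degree (N j k) + k = Q j * degree (P j)"
      unfolding N_def using row_numerator deg Qk[OF that] by blast+
  qed
  have g0: "g \<noteq> 0" unfolding g_def using J P0 by simp
  have "degree g = (\<Sum>j\<in>J. Q j * degree (P j))"
    unfolding g_def using P0 by (subst degree_prod_eq_sum_degree) (auto simp: degree_power_eq)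
  also have "\<dots> \<le> (\<Sum>j\<in>J. D j + degree (P j))"
    by (intro sum_mono) (simp add: Q_def)
  finally have dg: "degree g \<le> n" using n by simp
  have LH: "L * laurent_at_infinity g = laurent_at_infinity H"
    unfolding L_def H_def laurent_at_infinity_sum sum_distrib_right
  proof (intro sum.cong refl)
    fix z assume z: "z \<in> Z"
    then have "fst z \<in> J" using Z by auto
    then show "laurent_row (P (fst z)) (snd z) * laurent_at_infinity g =
        laurent_at_infinity (N (fst z) (snd z) * G (fst z))"
      using num(1)[of "fst z" "snd z"] z
      by (simp add: gG laurent_at_infinity_mult laurent_at_infinity_power mult.assoc[symmetric])
  qed
  \<comment> \<open>Vanishing in the first \<open>n\<close> columns makes the order of
    \<open>L\<close> at infinity exceed \<open>n\<close>, hence exceed the degree of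
    \<open>g\<close>. Then \<open>L * g\<close> would have positive order, but it comes from a
    polynomial.\<close>
  have "L = 0"
  proof (rule ccontr)
    assume L: "L \<noteq> 0"
    have "int n + 1 \<le> fls_subdegree L"
    proof (rule fls_subdegree_geI[OF L])
      fix l :: int assume l: "l < int n + 1"
      have nth: "fls_nth L l = (\<Sum>z\<in>Z. fls_nth (laurent_row (P (fst z)) (snd z)) l)"
        unfolding L_def by (rule fls_nth_sum)
      show "fls_nth L l = 0"
      proof (cases "1 \<le> l")
        case True
        then show ?thesis using zero[of "nat l"] l unfolding nth by simp
      next
        case False
        have "fls_nth (laurent_row (P j) k) l = 0" if "(j, k) \<in> Z" for j k
        proof (rule fls_eq0_below_subdegree)
          have "j \<in> J" "1 \<le> k" using Z that by auto
          then show "l < fls_subdegree (laurent_row (P j) k)"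
            using laurent_row_subdegree(2)[of "P j" k] deg False by simp
        qed
        then show ?thesis unfolding nth by (auto intro!: sum.neutral)
      qed
    qed
    moreover have "fls_subdegree L - int (degree g) = fls_subdegree (laurent_at_infinity H)"
      unfolding LH[symmetric] using L g0 by (simp add: fls_subdegree_laurent_at_infinity)
    moreover have "H \<noteq> 0" using LH L g0 by auto
    ultimately show False using dg by (simp add: fls_subdegree_laurent_at_infinity)
  qed
  then have H: "H = 0" using LH by simp
  \<comment> \<open>\<open>h\<close> collects the rows belonging to \<open>P j0\<close>. All other
    summands of \<open>H\<close> contain the full power \<open>P j0 ^ Q j0\<close>, and
    \<open>G j0\<close> is prime to \<open>P j0\<close>; thus this power divides \<open>h\<close>,
    whose degree is too small.\<close>
  define K where "K = {k. (j0, k) \<in> Z}"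
  define h where "h = (\<Sum>k\<in>K. N j0 k)"
  have j0: "j0 \<in> J" using Z jk0 by auto
  have "K = snd ` {z \<in> Z. fst z = j0}" by (force simp: K_def)
  then have finK: "finite K" using finZ by simp
  define A where "A = {z \<in> Z. fst z = j0}"
  have "(\<Sum>z\<in>A. N (fst z) (snd z) * G (fst z)) = (\<Sum>k\<in>K. N j0 k * G j0)"
    by (rule sum.reindex_bij_witness[of _ "\<lambda>k. (j0, k)" snd]) (auto simp: K_def A_def)
  moreover have "H = (\<Sum>z\<in>Z - A. N (fst z) (snd z) * G (fst z)) + (\<Sum>z\<in>A. N (fst z) (snd z) * G (fst z))"
    unfolding H_def by (rule sum.subset_diff) (use finZ in \<open>auto simp: A_def\<close>)
  ultimately have eq: "(\<Sum>z\<in>Z - A. N (fst z) (snd z) * G (fst z)) + h * G j0 = 0"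
    unfolding h_def sum_distrib_right using H by simp
  have rest: "P j0 ^ Q j0 dvd (\<Sum>z\<in>Z - A. N (fst z) (snd z) * G (fst z))"
  proof (rule dvd_sum)
    fix z assume "z \<in> Z - A"
    then show "P j0 ^ Q j0 dvd N (fst z) (snd z) * G (fst z)"
      unfolding G_def using J j0 by (intro dvd_mult dvd_prodI) (auto simp: A_def)
  qed
  have "P j0 ^ Q j0 dvd h * G j0" using dvd_add_right_iff[OF rest, of "h * G j0"] unfolding eq by simp
  moreover have prime: "prime_elem (P j0)" using irr[OF j0] by (rule field_poly_irreducible_imp_prime)
  moreover have "\<not> P j0 dvd G j0"
    unfolding G_def using J j0 prime
    by (intro prime_elem_not_dvd_prod[OF prime]) (auto simp: prime_elem_dvd_power_iff ndvd)
  ultimately have dvd: "P j0 ^ Q j0 dvd h"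
    using prime_elem_power_dvd_cases[of "P j0" "Q j0" h "G j0" "Q j0" 1] by simp
  define k1 where "k1 = Min K"
  have k0: "k0 \<in> K" using jk0 by (simp add: K_def)
  have k1: "k1 \<in> K" "\<And>k. k \<in> K \<Longrightarrow> k1 \<le> k" unfolding k1_def using finK k0 by (auto intro: Min_in)
  have deg_le: "degree (N j0 k) + k = Q j0 * degree (P j0)" if "k \<in> K" for k
    using num(3) that by (simp add: K_def)
  \<comment> \<open>The smallest row has the numerator of strictly largest degree, so its leading
    term, with coefficient 1 over the two-element field, cannot cancel.\<close>
  have "coeff h (degree (N j0 k1)) = (\<Sum>k\<in>K. if k = k1 then 1 else 0)"
    unfolding h_def coeff_sum
  proof (intro sum.cong refl)
    fix k assume k: "k \<in> K"
    show "coeff (N j0 k) (degree (N j0 k1)) = (if k = k1 then 1 else 0)"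
    proof (cases "k = k1")
      case True
      have "lead_coeff (N j0 k) \<noteq> 0"
        using num(2)[of j0 k] k by (simp add: K_def del: bit_not_zero_iff)
      then have "lead_coeff (N j0 k) = 1" by (simp only: bit_not_zero_iff)
      then show ?thesis by (simp only: True if_True simp_thms)
    next
      case False
      then have "k1 < k" using k1(2)[OF k] by simp
      then have "degree (N j0 k) < degree (N j0 k1)" using deg_le[OF k] deg_le[OF k1(1)] by simp
      then show ?thesis using False by (simp add: coeff_eq_0)
    qed
  qed
  then have h0: "h \<noteq> 0" using finK k1(1) by auto
  have "degree h \<le> degree (N j0 k1)"
    unfolding h_def using deg_le deg_le[OF k1(1)] k1(2) finK by (intro degree_sum_le) (auto, force)
  also have "\<dots> < Q j0 * degree (P j0)"
    using deg_le[OF k1(1)] k1(1) Z by (auto simp: K_def)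
  also have "\<dots> = degree (P j0 ^ Q j0)" using P0[OF j0] by (simp add: degree_power_eq)
  also have "\<dots> \<le> degree h" using dvd h0 by (rule dvd_imp_degree_le)
  finally show False by simp
qed

section \<open>Digits of interlaced sequences\<close>

text \<open>As only finitely many digits are nonzero, every tail is strictly below 1. Doubling
  therefore shifts out one digit at a time, and the parity of the floor reads it off.\<close>

lemma binary_expansion:
  fixes f :: "nat \<Rightarrow> bool" and y :: real
  assumes f: "\<forall>v>V. \<not> f v" and y: "y = (\<Sum>v. of_bool (f (Suc v)) / 2 ^ Suc v)"
  shows "0 \<le> y" "y < 1" "1 \<le> v \<Longrightarrow> odd \<lfloor>2 ^ v * y\<rfloor> \<longleftrightarrow> f v"
proof -
  define z :: "nat \<Rightarrow> real" where "z j = (\<Sum>v. of_bool (f (Suc (v + j))) / 2 ^ Suc v)" for j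
  have z: "z j = (\<Sum>v<W. of_bool (f (Suc (v + j))) / 2 ^ Suc v)" if "V \<le> W + j" for j W
    unfolding z_def using f that by (intro suminf_finite) auto
  have z01: "0 \<le> z j" "z j < 1" for j
  proof -
    have "(\<Sum>v<V. 1 / 2 ^ Suc v :: real) = 1 - 1 / 2 ^ V"
      by (induction V) (simp_all add: field_simps)
    moreover have "z j \<le> (\<Sum>v<V. 1 / 2 ^ Suc v)"
      by (subst z[of V]) (auto intro!: sum_mono simp: divide_right_mono)
    moreover have "0 < 1 / (2::real) ^ V" by simp
    ultimately show "z j < 1" by linarith
    show "0 \<le> z j" by (subst z[of V]) (auto intro!: sum_nonneg)
  qed
  have step: "2 * z j = of_bool (f (Suc j)) + z (Suc j)" for j
  proof -
    have "2 * z j = 2 * (\<Sum>v<Suc V. of_bool (f (Suc (v + j))) / 2 ^ Suc v)"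
      by (subst z[of "Suc V"]) simp_all
    also have "\<dots> = of_bool (f (Suc j)) + (\<Sum>v<V. of_bool (f (Suc (v + Suc j))) / 2 ^ Suc v)"
      by (subst sum.lessThan_Suc_shift) (simp add: sum_distrib_left)
    also have "\<dots> = of_bool (f (Suc j)) + z (Suc j)" by (subst z[of V]) simp_all
    finally show ?thesis .
  qed
  have int: "\<exists>a::int. 2 ^ j * z 0 = of_int a + z j" for j
  proof (induction j)
    case (Suc j)
    then obtain a :: int where "2 ^ j * z 0 = of_int a + z j" by blast
    then have "2 ^ Suc j * z 0 = of_int (2 * a + of_bool (f (Suc j))) + z (Suc j)"
      using step[of j] by simp
    then show ?case by blast
  qed (auto intro: exI[of _ 0])
  have yz: "y = z 0" by (simp add: y z_def)
  then show "0 \<le> y" "y < 1" using z01 by auto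
  show "odd \<lfloor>2 ^ v * y\<rfloor> \<longleftrightarrow> f v" if v: "1 \<le> v"
  proof -
    obtain j where j: "v = Suc j" using v by (cases v) auto
    obtain a :: int where "2 ^ j * z 0 = of_int a + z j" using int by blast
    then have "2 ^ v * y = of_int (2 * a + of_bool (f v)) + z v"
      using step[of j] by (simp add: j yz)
    then have "\<lfloor>2 ^ v * y\<rfloor> = 2 * a + of_bool (f v)"
      using z01[of v] by (intro floor_unique) auto
    then show ?thesis by simp
  qed
qed

section \<open>Characters and digits of digital sequences\<close>

definition bit_sign :: "bit \<Rightarrow> real" where
  "bit_sign b = (if b = 1 then -1 else 1)"

lemma bit_sign_0 [simp]: "bit_sign 0 = 1"
  by (simp add: bit_sign_def)

lemma bit_sign_add: "bit_sign (a + b) = bit_sign a * bit_sign b"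
  by (cases a; cases b) (simp_all add: bit_sign_def)

lemma bit_sign_sum: "bit_sign (\<Sum>i\<in>A. f i) = (\<Prod>i\<in>A. bit_sign (f i))"
proof (induction A rule: infinite_finite_induct)
  case (insert i A)
  show ?case by (simp only: sum.insert[OF insert.hyps] prod.insert[OF insert.hyps] bit_sign_add insert.IH)
qed simp_all

lemma bit_nat_less:
  fixes p :: nat
  assumes "p < 2 ^ n" "bit p i"
  shows "i < n"
  using bit_nat_bounds(1)[OF assms(2)] assms(1) by (meson le_less_trans nat_power_less_imp_less pos2)

lemma digital_digit_eq:
  assumes "p < 2 ^ n"
  shows "digital_digit C p k = (\<Sum>l=1..n. C k l * of_bool (bit p (l - 1)))"
proof -
  have "l \<le> p" "l \<le> n" if "1 \<le> l" "bit p (l - 1)" for l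
  proof -
    show "l \<le> n" using bit_nat_less[OF assms that(2)] that(1) by simp
    have "l - 1 < 2 ^ (l - 1)" by (rule less_exp)
    then show "l \<le> p" using bit_nat_bounds(1)[OF that(2)] that(1) by linarith
  qed
  then show ?thesis
    unfolding digital_digit_def by (intro sum.mono_neutral_cong) auto
qed

text \<open>The binary digits of \<open>M\<close> and \<open>p\<close> occupy disjoint positions, so
  the addition has no carries and the matrix product is additive. This yields \<open>shift\<close>
  of \<open>dyadic_net\<close>.\<close>

lemma digital_digit_add:
  assumes p: "p < 2 ^ n" and M: "2 ^ n dvd M"
  shows "digital_digit C (M + p) k = digital_digit C M k + digital_digit C p k"
proof -
  define m where "m = M + p"
  have "m < 2 ^ m" "M < 2 ^ m" "p < 2 ^ m" using less_exp[of m] unfolding m_def by linarith+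
  note d = this[THEN digital_digit_eq]
  obtain c where c: "M = push_bit n c" using M by (auto simp: push_bit_eq_mult mult.commute elim: dvdE)
  have dis: "\<not> bit M i \<or> \<not> bit p i" for i
    using bit_nat_less[OF p, of i] by (auto simp: c bit_push_bit_iff)
  then have "M + p = or M p" by (rule disjunctive_add)
  then have *: "of_bool (bit m i) = (of_bool (bit M i) + of_bool (bit p i) :: bit)" for i
    using dis[of i] by (auto simp: m_def bit_or_iff)
  show ?thesis
    unfolding m_def[symmetric] d by (simp only: * distrib_left sum.distrib)
qed

lemma sum_prod_bits:
  fixes h :: "nat \<Rightarrow> bool \<Rightarrow> 'a::comm_semiring_1"
  shows "(\<Sum>p::nat<2 ^ n. \<Prod>l<n. h l (bit p l)) = (\<Prod>l<n. h l False + h l True)"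
proof (induction n)
  case (Suc n)
  have b: "bit (2 ^ n + p) l = (if l = n then True else bit p l)" if "p < 2 ^ n" "l \<le> n" for p l :: nat
  proof -
    have "2 ^ n + p = or (2 ^ n) p"
      using bit_nat_less[OF that(1)] by (intro disjunctive_add) (auto simp: bit_exp_iff)
    then show ?thesis using bit_nat_less[OF that(1)] by (auto simp: bit_or_iff bit_exp_iff)
  qed
  have "(\<Sum>p::nat<2 ^ Suc n. \<Prod>l<Suc n. h l (bit p l)) =
      (\<Sum>p::nat<2 ^ n. \<Prod>l<Suc n. h l (bit p l)) + (\<Sum>p::nat<2 ^ n. \<Prod>l<Suc n. h l (bit (2 ^ n + p) l))"
    using sum.atLeastLessThan_concat[of 0 "2 ^ n" "2 ^ Suc n" "\<lambda>p. \<Prod>l<Suc n. h l (bit p l)"]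
      sum.shift_bounds_nat_ivl[of "\<lambda>p. \<Prod>l<Suc n. h l (bit p l)" 0 "2 ^ n" "2 ^ n"]
    by (simp add: lessThan_atLeast0 add.commute mult_2 del: prod.lessThan_Suc prod.op_ivl_Suc)
  also have "(\<Sum>p::nat<2 ^ n. \<Prod>l<Suc n. h l (bit p l)) = (\<Sum>p::nat<2 ^ n. (\<Prod>l<n. h l (bit p l)) * h n False)"
  proof (intro sum.cong refl)
    fix p :: nat assume "p \<in> {..<2 ^ n}"
    then have "\<not> bit p n" using bit_nat_less[of p n n] by auto
    then show "(\<Prod>l<Suc n. h l (bit p l)) = (\<Prod>l<n. h l (bit p l)) * h n False" by simp
  qed
  also have "(\<Sum>p::nat<2 ^ n. \<Prod>l<Suc n. h l (bit (2 ^ n + p) l)) = (\<Sum>p::nat<2 ^ n. (\<Prod>l<n. h l (bit p l)) * h n True)"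
    by (intro sum.cong refl) (simp add: b)
  finally show ?case
    unfolding sum_distrib_right[symmetric] Suc by (simp add: distrib_left)
qed simp

text \<open>Orthogonality of characters: by \<open>sum_prod_bits\<close> the sum factorises over the
  bits of \<open>p\<close>, and the factor of column \<open>l\<close> is
  \<open>1 + (-1)\<close>.\<close>

lemma sum_bit_sign_eq_0:
  assumes "l \<in> {1..n}" "G l = 1"
  shows "(\<Sum>p<2 ^ n. bit_sign (\<Sum>l=1..n. G l * of_bool (bit (p::nat) (l - 1)))) = 0"
proof -
  have *: "(\<Sum>l=1..n. G l * of_bool (bit p (l - 1))) = (\<Sum>l<n. G (Suc l) * of_bool (bit p l))" for p :: nat
    by (rule sum.reindex_bij_witness[of _ Suc "\<lambda>l. l - 1"]) auto
  have "(\<Sum>p<2 ^ n. bit_sign (\<Sum>l=1..n. G l * of_bool (bit (p::nat) (l - 1)))) =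
      (\<Sum>p<2 ^ n. \<Prod>l<n. bit_sign (G (Suc l) * of_bool (bit (p::nat) l)))"
    by (simp only: * bit_sign_sum)
  also have "\<dots> = (\<Prod>l<n. bit_sign (G (Suc l) * of_bool False) + bit_sign (G (Suc l) * of_bool True))"
    by (rule sum_prod_bits)
  also have "\<dots> = 0"
    using assms by (intro prod_zero finite_lessThan bexI[of _ "l - 1"]) (auto simp: bit_sign_def)
  finally show ?thesis .
qed

lemma digital_digit_triangular:
  assumes "\<And>l. l < k \<Longrightarrow> C k l = 0" "n < k"
  shows "digital_digit C n k = 0"
  unfolding digital_digit_def using assms by (intro sum.neutral) auto

lemma digital_coord_digits:
  assumes C: "\<And>k l. 1 \<le> k \<Longrightarrow> l < k \<Longrightarrow> C k l = 0"
  shows "0 \<le> digital_coord C n" "digital_coord C n < 1"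
    "1 \<le> v \<Longrightarrow> dyadic_digit (digital_coord C n) v = of_bool (digital_digit C n v = 1)"
proof -
  have f: "\<forall>v>n. \<not> digital_digit C n v = 1"
  proof (intro allI impI)
    fix v assume v: "n < v"
    then have "digital_digit C n v = 0" by (intro digital_digit_triangular C) auto
    then show "\<not> digital_digit C n v = 1" by simp
  qed
  note * = binary_expansion[of n "\<lambda>v. digital_digit C n v = 1", OF f digital_coord_def]
  show "0 \<le> digital_coord C n" "digital_coord C n < 1" by (rule *)+
  show "dyadic_digit (digital_coord C n) v = of_bool (digital_digit C n v = 1)" if "1 \<le> v"
    using *(3)[OF that] unfolding dyadic_digit_def mod_2_eq_odd by simp
qed

text \<open>The common bound \<open>V\<close> turns the series into a finite sum over blocks of
  \<open>\<alpha>\<close> consecutive positions. The regrouped expansion is again finite, so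
  \<open>binary_expansion\<close> identifies its digits.\<close>

lemma interlace_digits:
  fixes f :: "nat \<Rightarrow> nat \<Rightarrow> bool"
  assumes \<alpha>: "1 \<le> \<alpha>"
    and f: "\<forall>r\<in>{1..\<alpha>}. \<forall>a\<ge>1. dyadic_digit (X r) a = of_bool (f r a)"
    and V: "\<forall>r\<in>{1..\<alpha>}. \<forall>a>V. \<not> f r a"
  shows "0 \<le> interlace \<alpha> X" "interlace \<alpha> X < 1"
    "1 \<le> v \<Longrightarrow> odd \<lfloor>2 ^ v * interlace \<alpha> X\<rfloor> \<longleftrightarrow> f ((v - 1) mod \<alpha> + 1) ((v - 1) div \<alpha> + 1)"
proof -
  define F where "F w = f ((w - 1) mod \<alpha> + 1) ((w - 1) div \<alpha> + 1)" for w
  have mod: "w mod \<alpha> + 1 \<le> \<alpha>" for w using \<alpha> by (simp add: Suc_leI)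
  have F: "\<forall>w>V * \<alpha>. \<not> F w"
  proof (intro allI impI)
    fix w assume "V * \<alpha> < w"
    then have "V * \<alpha> \<le> w - 1" by simp
    then have "V \<le> (w - 1) div \<alpha>" using \<alpha> by (simp add: less_eq_div_iff_mult_less_eq)
    then show "\<not> F w" unfolding F_def using V mod by simp
  qed
  have "interlace \<alpha> X = (\<Sum>a. \<Sum>r=1..\<alpha>. of_bool (f r (Suc a)) / 2 ^ (r + a * \<alpha>))"
    unfolding interlace_def using f by (intro suminf_cong sum.cong refl) auto
  also have "\<dots> = (\<Sum>a<V. \<Sum>r=1..\<alpha>. of_bool (f r (Suc a)) / 2 ^ (r + a * \<alpha>))"
    using V by (intro suminf_finite) auto
  also have "\<dots> = (\<Sum>a<V. \<Sum>w\<in>{a * \<alpha>..<a * \<alpha> + \<alpha>}. of_bool (F (Suc w)) / 2 ^ Suc w)"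
  proof (rule sum.cong[OF refl])
    fix a
    show "(\<Sum>r=1..\<alpha>. of_bool (f r (Suc a)) / 2 ^ (r + a * \<alpha>)) =
      (\<Sum>w\<in>{a * \<alpha>..<a * \<alpha> + \<alpha>}. of_bool (F (Suc w)) / 2 ^ Suc w :: real)"
    proof -
      have "(\<Sum>w\<in>{a * \<alpha>..<a * \<alpha> + \<alpha>}. of_bool (F (Suc w)) / 2 ^ Suc w :: real) =
          (\<Sum>t<\<alpha>. of_bool (F (Suc (a * \<alpha> + t))) / 2 ^ Suc (a * \<alpha> + t))"
        by (rule sum.reindex_bij_witness[of _ "\<lambda>t. a * \<alpha> + t" "\<lambda>w. w - a * \<alpha>"]) auto
      also have "\<dots> = (\<Sum>t<\<alpha>. of_bool (f (Suc t) (Suc a)) / 2 ^ (Suc t + a * \<alpha>))"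
        by (intro sum.cong refl) (simp add: F_def add.commute)
      also have "\<dots> = (\<Sum>r=1..\<alpha>. of_bool (f r (Suc a)) / 2 ^ (r + a * \<alpha>))"
        by (rule sum.reindex_bij_witness[of _ "\<lambda>r. r - 1" Suc]) auto
      finally show ?thesis by (rule sym)
    qed
  qed
  also have "\<dots> = (\<Sum>w<V * \<alpha>. of_bool (F (Suc w)) / 2 ^ Suc w)"
    by (rule sum.nat_group)
  also have "\<dots> = (\<Sum>w. of_bool (F (Suc w)) / 2 ^ Suc w)"
    using F by (intro suminf_finite[symmetric]) auto
  finally have eq: "interlace \<alpha> X = (\<Sum>w. of_bool (F (Suc w)) / 2 ^ Suc w)" .
  note * = binary_expansion[of "V * \<alpha>" F, OF F eq]
  show "0 \<le> interlace \<alpha> X" "interlace \<alpha> X < 1" by (rule *)+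
  show "odd \<lfloor>2 ^ v * interlace \<alpha> X\<rfloor> \<longleftrightarrow> f ((v - 1) mod \<alpha> + 1) ((v - 1) div \<alpha> + 1)" if "1 \<le> v"
    using *(3)[OF that] by (simp add: F_def)
qed

lemma irreducible_bit_poly_dvd_imp_eq:
  fixes p q :: "bit poly"
  assumes "irreducible p" "irreducible q" "p dvd q"
  shows "p = q"
proof -
  obtain c where c: "q = p * c" using assms(3) by (rule dvdE)
  then have "is_unit c" using assms(1,2) by (auto simp: irreducible_def)
  then obtain b :: bit where "c = [:b:]" "b \<noteq> 0" by (auto simp: is_unit_poly_iff)
  \<comment> \<open>Over the two-element field 1 is the only nonzero constant, so associated
    polynomials are equal.\<close>
  then have "c = 1" by (simp only: bit_not_zero_iff one_pCons)
  then show ?thesis using c by simp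
qed

section \<open>The interlaced Sobol' sequence as a dyadic net\<close>

context
  fixes q :: "nat \<Rightarrow> bit poly"
  assumes q: "primitive_enumeration q"
begin

lemma primitive_poly_enum: "1 \<le> j \<Longrightarrow> primitive_poly (q j)"
  using q by (auto simp: primitive_enumeration_def bij_betw_def)

lemma irreducible_sobol_poly:
  assumes "1 \<le> j"
  shows "irreducible (sobol_poly q j)"
proof (cases "j = 1")
  case True
  then show ?thesis by (simp add: sobol_poly_def irreducible_linear_field_poly)
next
  case False
  then show ?thesis
    using primitive_poly_enum[of "j - 1"] assms by (simp add: sobol_poly_def primitive_poly_def)
qed

lemma degree_sobol_poly:
  assumes "1 \<le> j"
  shows "0 < degree (sobol_poly q j)"
  using irreducible_sobol_poly[OF assms] by (metis irreducible_def not_gr_zero is_unit_iff_degree)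

text \<open>Divisibility between these irreducibles means equality. The enumeration is injective,
  and it never yields \<open>x\<close>, which is not primitive.\<close>

lemma sobol_poly_not_dvd:
  assumes "1 \<le> i" "1 \<le> j" "i \<noteq> j"
  shows "\<not> sobol_poly q i dvd sobol_poly q j"
proof
  assume "sobol_poly q i dvd sobol_poly q j"
  then have eq: "sobol_poly q i = sobol_poly q j"
    using irreducible_sobol_poly assms by (intro irreducible_bit_poly_dvd_imp_eq) auto
  have ne: "q j \<noteq> [:0, 1:]" if "1 \<le> j" for j
    using primitive_poly_enum[OF that] by (auto simp: primitive_poly_def)
  have "inj_on q {1..}" using q by (simp add: primitive_enumeration_def bij_betw_def)
  moreover have "i \<noteq> 1 \<Longrightarrow> 1 \<le> i - 1" "j \<noteq> 1 \<Longrightarrow> 1 \<le> j - 1" using assms by auto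
  moreover have "i - 1 \<noteq> j - 1" using assms by auto
  ultimately show False
    using eq ne[of "i - 1"] ne[of "j - 1"] assms(3) unfolding sobol_poly_def
    by (cases "i = 1"; cases "j = 1") (auto simp: inj_on_def)
qed

lemma sobol_matrix_triangular:
  assumes "1 \<le> j" "1 \<le> k" "l < k"
  shows "sobol_matrix q j k l = 0"
  unfolding sobol_matrix_eq
  using laurent_row_subdegree(2)[OF degree_sobol_poly[OF assms(1)] assms(2)] assms(3)
  by (intro fls_eq0_below_subdegree) simp

abbreviation (input) "interlaced_sobol s \<equiv> interlace_sequence 5 s (sobol_sequence (5 * s) q)"

lemma interlaced_sobol_digits:
  assumes i: "i \<in> {1..s}"
  shows "0 \<le> interlaced_sobol s p i" "interlaced_sobol s p i < 1"
    "1 \<le> v \<Longrightarrow> rad v (interlaced_sobol s p i) = bit_sign (digital_digit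
       (sobol_matrix q ((i - 1) * 5 + ((v - 1) mod 5 + 1))) p ((v - 1) div 5 + 1))"
proof -
  let ?X = "\<lambda>r. sobol_sequence (5 * s) q p ((i - 1) * 5 + r)"
  let ?C = "\<lambda>r. sobol_matrix q ((i - 1) * 5 + r)"
  have S_eq: "interlaced_sobol s p i = interlace 5 ?X"
    using i by (simp add: interlace_sequence_def interlace_point_def)
  have X: "?X r = digital_coord (?C r) p" if "1 \<le> r" "r \<le> 5" for r
    using i that by (auto simp: sobol_sequence_def digital_sequence_def)
  have C: "?C r k l = 0" if "1 \<le> r" "1 \<le> k" "l < k" for r k l
    using that by (intro sobol_matrix_triangular) auto
  have d: "\<forall>r\<in>{1..5}. \<forall>a\<ge>1. dyadic_digit (?X r) a = of_bool (digital_digit (?C r) p a = 1)"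
  proof (intro ballI allI impI)
    fix r a :: nat assume ra: "r \<in> {1..5}" "1 \<le> a"
    then have "?X r = digital_coord (?C r) p" by (intro X) auto
    then show "dyadic_digit (?X r) a = of_bool (digital_digit (?C r) p a = 1)"
      using digital_coord_digits(3)[of "?C r" a p] C ra by auto
  qed
  have V: "\<forall>r\<in>{1..5}. \<forall>a>p. \<not> digital_digit (?C r) p a = 1"
  proof (intro ballI allI impI)
    fix r a :: nat assume ra: "r \<in> {1..5}" "p < a"
    then have "digital_digit (?C r) p a = 0" by (intro digital_digit_triangular C) auto
    then show "\<not> digital_digit (?C r) p a = 1" by simp
  qed
  have "(1::nat) \<le> 5" by simp
  note * = interlace_digits[OF this d V]
  show "0 \<le> interlaced_sobol s p i" "interlaced_sobol s p i < 1" unfolding S_eq by (rule *)+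
  show "rad v (interlaced_sobol s p i) = bit_sign (digital_digit
       (sobol_matrix q ((i - 1) * 5 + ((v - 1) mod 5 + 1))) p ((v - 1) div 5 + 1))" if "1 \<le> v"
    unfolding S_eq rad_def bit_sign_def using *(3)[OF that] by simp
qed

text \<open>For \<open>p < 2 ^ n\<close>, \<open>walsh Z\<close> is the character of the linear form
  whose coefficients \<open>G l\<close> add up the matrix rows selected by \<open>Z\<close>. A
  nonzero coefficient makes the sum cancel; otherwise these rows would be dependent on the first
  \<open>n\<close> columns, against \<open>laurent_rows_independent\<close>.\<close>

lemma interlaced_sobol_independent:
  assumes E: "(\<Sum>j=1..5 * s. degree (sobol_poly q j)) \<le> E"
    and Z: "Z \<noteq> {}" "Z \<subseteq> {(i, v). i \<in> {1..s} \<and> 1 \<le> v \<and> (v \<le> k i \<or> v = k i + a i)}"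
    and n: "(\<Sum>i=1..s. 5 * k i + a i) + (25 * s + 5 * E) \<le> 5 * n"
  shows "(\<Sum>p<2 ^ n. walsh Z (interlaced_sobol s p)) = 0"
proof -
  \<comment> \<open>Undoes the interlacing: a coordinate and a digit position are sent to the Sobol'
    component and the matrix row that produce this digit.\<close>
  define \<phi> where "\<phi> z = ((fst z - 1) * 5 + ((snd z - 1) mod 5 + 1), (snd z - 1) div 5 + 1)" for z :: "nat \<times> nat"
  define G where "G l = (\<Sum>z\<in>Z. sobol_matrix q (fst (\<phi> z)) (snd (\<phi> z)) l)" for l
  have walsh: "walsh Z (interlaced_sobol s p) = bit_sign (\<Sum>l=1..n. G l * of_bool (bit p (l - 1)))" if p: "p < 2 ^ n" for p
  proof -
    have "walsh Z (interlaced_sobol s p) = (\<Prod>z\<in>Z. bit_sign (digital_digit (sobol_matrix q (fst (\<phi> z))) p (snd (\<phi> z))))"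
      unfolding walsh_def
    proof (rule prod.cong[OF refl])
      fix z assume "z \<in> Z"
      then have "fst z \<in> {1..s}" "1 \<le> snd z" using Z(2) by auto
      then show "rad (snd z) (interlaced_sobol s p (fst z)) =
          bit_sign (digital_digit (sobol_matrix q (fst (\<phi> z))) p (snd (\<phi> z)))"
        unfolding \<phi>_def fst_conv snd_conv by (rule interlaced_sobol_digits(3))
    qed
    also have "\<dots> = bit_sign (\<Sum>z\<in>Z. \<Sum>l=1..n. sobol_matrix q (fst (\<phi> z)) (snd (\<phi> z)) l * of_bool (bit p (l - 1)))"
      by (simp only: bit_sign_sum[of _ Z] digital_digit_eq[OF p])
    also have "(\<Sum>z\<in>Z. \<Sum>l=1..n. sobol_matrix q (fst (\<phi> z)) (snd (\<phi> z)) l * of_bool (bit p (l - 1))) =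
        (\<Sum>l=1..n. G l * of_bool (bit p (l - 1)))"
      unfolding G_def sum_distrib_right by (rule sum.swap)
    finally show ?thesis .
  qed
  show ?thesis
  proof (cases "\<exists>l\<in>{1..n}. G l = 1")
    case True
    then obtain l where l: "l \<in> {1..n}" "G l = 1" by blast
    have "(\<Sum>p<2 ^ n. walsh Z (interlaced_sobol s p)) = (\<Sum>p::nat<2 ^ n. bit_sign (\<Sum>l=1..n. G l * of_bool (bit p (l - 1))))"
      by (intro sum.cong[OF refl] walsh) simp
    then show ?thesis using sum_bit_sign_eq_0[of l n G] l by simp
  next
    case False
    \<comment> \<open>\<open>r i\<close> is the one among the five components of coordinate
      \<open>i\<close> that holds position \<open>k i + a i\<close>. Only this component needs rows
      beyond those of positions up to \<open>k i\<close>.\<close>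
    define r where "r i = (k i + a i - 1) mod 5 + 1" for i
    define D where "D j = (let i = (j - 1) div 5 + 1 in
      if (j - 1) mod 5 + 1 = r i then (k i + a i) div 5 + 1 else k i div 5 + 1)" for j
    have inj: "inj_on \<phi> Z"
    proof (rule inj_onI)
      fix z w assume zw: "z \<in> Z" "w \<in> Z" "\<phi> z = \<phi> w"
      have ge: "1 \<le> fst z" "1 \<le> snd z" "1 \<le> fst w" "1 \<le> snd w" using zw Z(2) by auto
      have eq: "(fst z - 1) * 5 + (snd z - 1) mod 5 = (fst w - 1) * 5 + (snd w - 1) mod 5"
        "(snd z - 1) div 5 = (snd w - 1) div 5" using zw(3) by (auto simp: \<phi>_def)
      have "b = d \<and> c = e" if "b * 5 + c = d * 5 + e" "c < 5" "e < 5" for b c d e :: nat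
        using that by presburger
      from this[OF eq(1)] have "fst z - 1 = fst w - 1" "(snd z - 1) mod 5 = (snd w - 1) mod 5" by simp_all
      moreover from this(2) eq(2) have "snd z - 1 = snd w - 1" by (metis div_mult_mod_eq)
      ultimately have "fst z = fst w" "snd z = snd w" using ge by linarith+
      then show "z = w" by (rule prod_eqI)
    qed
    have "\<phi> ` Z \<subseteq> {(j, c). j \<in> {1..5 * s} \<and> 1 \<le> c \<and> c \<le> D j}"
    proof (rule image_subsetI)
      fix z assume z: "z \<in> Z"
      obtain i v where iv: "z = (i, v)" by (cases z)
      define j where "j = (i - 1) * 5 + ((v - 1) mod 5 + 1)"
      have i: "i \<in> {1..s}" "1 \<le> v" "v \<le> k i \<or> v = k i + a i" using Z(2) z iv by auto
      have j: "(j - 1) div 5 + 1 = i" "(j - 1) mod 5 = (v - 1) mod 5"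
        using i(1) by (auto simp: j_def)
      have "1 \<le> j" "j \<le> 5 * s"
        using i(1) j_def mod_less_divisor[of 5 "v - 1"] by (auto simp: algebra_simps) 
      moreover have "(v - 1) div 5 + 1 \<le> D j"
      proof -
        have D: "D j = (if (v - 1) mod 5 + 1 = r i then (k i + a i) div 5 + 1 else k i div 5 + 1)"
          unfolding D_def Let_def j ..
        show ?thesis
        proof (cases "v = k i + a i")
          case True
          then have "D j = v div 5 + 1" unfolding D r_def by simp
          then show ?thesis by (simp add: div_le_mono)
        next
          case False
          then have "v - 1 \<le> k i" "v - 1 \<le> k i + a i" using i(3) by auto
          then show ?thesis unfolding D by (simp add: div_le_mono)
        qed
      qed
      ultimately show "\<phi> z \<in> {(j, c). j \<in> {1..5 * s} \<and> 1 \<le> c \<and> c \<le> D j}"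
        by (simp add: \<phi>_def iv j_def)
    qed
    moreover have "(\<Sum>j=1..5 * s. D j + degree (sobol_poly q j)) \<le> n"
    proof -
      have "(\<Sum>j=1..5 * s. 5 * D j) = (\<Sum>j<s * 5. 5 * D (Suc j))"
        by (rule sum.reindex_bij_witness[of _ Suc "\<lambda>j. j - 1"]) auto
      also have "\<dots> = (\<Sum>i<s. \<Sum>j\<in>{i * 5..<i * 5 + 5}. 5 * D (Suc j))"
        by (rule sum.nat_group[symmetric])
      also have "\<dots> \<le> (\<Sum>i<s. 5 * k (Suc i) + a (Suc i) + 25)"
      proof (rule sum_mono)
        fix i :: nat
        have "{i * 5..<i * 5 + 5} = {i * 5, i * 5 + 1, i * 5 + 2, i * 5 + 3, i * 5 + 4}" by auto
        moreover define h A where "h = k (Suc i) div 5 + 1" and "A = (k (Suc i) + a (Suc i)) div 5 + 1"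
        have D: "D (Suc (i * 5 + t)) = (if t + 1 = r (Suc i) then A else h)" if "t < 5" for t :: nat
          using that by (simp add: D_def Let_def h_def A_def)
        have five: "(if 0 + 1 = \<rho> then A else h) + (if 1 + 1 = \<rho> then A else h) + (if 2 + 1 = \<rho> then A else h)
            + (if 3 + 1 = \<rho> then A else h) + (if 4 + 1 = \<rho> then A else h) \<le> A + 4 * h" if "h \<le> A" for \<rho> h A :: nat
          using that by simp
        have "h \<le> A" by (simp add: h_def A_def div_le_mono)
        then have "D (Suc (i * 5 + 0)) + D (Suc (i * 5 + 1)) + D (Suc (i * 5 + 2)) + D (Suc (i * 5 + 3))
            + D (Suc (i * 5 + 4)) \<le> A + 4 * h"
          by (subst (1 2 3 4 5) D; (rule five)?) simp_all
        \<comment> \<open>One component with \<open>A\<close> rows and four with \<open>h\<close>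
          rows give \<open>5 * (A + 4 * h)\<close>, at most \<open>5 * k + a + 25\<close> for this
          coordinate. This is the source of \<open>25 * s\<close> in the defect;
          \<open>5 * E\<close> pays for the degrees.\<close>
        moreover have "5 * A \<le> k (Suc i) + a (Suc i) + 5" "5 * h \<le> k (Suc i) + 5"
          by (simp_all add: h_def A_def)
        ultimately show "(\<Sum>j\<in>{i * 5..<i * 5 + 5}. 5 * D (Suc j)) \<le> 5 * k (Suc i) + a (Suc i) + 25"
          by simp
      qed
      also have "\<dots> = (\<Sum>i=1..s. 5 * k i + a i + 25)"
        by (rule sum.reindex_bij_witness[of _ "\<lambda>j. j - 1" Suc]) auto
      also have "\<dots> = (\<Sum>i=1..s. 5 * k i + a i) + 25 * s"
        by (simp add: sum.distrib)
      finally show ?thesis using n E by (simp add: sum.distrib sum_distrib_left[symmetric])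
    qed
    moreover have "(\<Sum>z\<in>\<phi> ` Z. fls_nth (laurent_row (sobol_poly q (fst z)) (snd z)) (int l)) = 0"
      if "1 \<le> l" "l \<le> n" for l
    proof -
      have "(\<Sum>z\<in>\<phi> ` Z. fls_nth (laurent_row (sobol_poly q (fst z)) (snd z)) (int l)) = G l"
        unfolding G_def sobol_matrix_eq by (simp only: sum.reindex[OF inj] o_def)
      then show ?thesis using False that by auto
    qed
    ultimately have "\<phi> ` Z = {}"
      using irreducible_sobol_poly sobol_poly_not_dvd
      by (intro laurent_rows_independent[of "{1..5 * s}" "sobol_poly q" "\<phi> ` Z" D n]) auto
    then show ?thesis using Z(1) by simp
  qed
qed

lemma interlaced_sobol_net:
  assumes "(\<Sum>j=1..5 * s. degree (sobol_poly q j)) \<le> E"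
  shows "dyadic_net s (25 * s + 5 * E) (interlaced_sobol s)"
proof
  show "0 \<le> interlaced_sobol s p i \<and> interlaced_sobol s p i < 1" if "i \<in> {1..s}" for p i
    using interlaced_sobol_digits[OF that] by blast
  show "rad v (interlaced_sobol s (M + p) i) = rad v (interlaced_sobol s M i) * rad v (interlaced_sobol s p i)"
    if "i \<in> {1..s}" "1 \<le> v" "p < 2 ^ n" "2 ^ n dvd M" for i v p n M
    unfolding interlaced_sobol_digits(3)[OF that(1,2)] digital_digit_add[OF that(3,4)] bit_sign_add ..
qed (rule interlaced_sobol_independent[OF assms])

end

section \<open>The discrepancy bound\<close>

text \<open>Pigeonhole: if \<open>q j\<close> had larger degree than \<open>r j\<close>, the
  \<open>j\<close> polynomials \<open>r 1, ..., r j\<close> would all occur among the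
  \<open>j - 1\<close> values of \<open>q\<close> before \<open>j\<close>. By symmetry all
  enumerations have the same degrees.\<close>

lemma degree_primitive_enumeration_le:
  assumes q: "primitive_enumeration q" and r: "primitive_enumeration r" and j: "1 \<le> j"
  shows "degree (q j) \<le> degree (r j)"
proof (rule ccontr)
  assume less: "\<not> degree (q j) \<le> degree (r j)"
  have bij: "bij_betw q {1..} {p. primitive_poly p}" "bij_betw r {1..} {p. primitive_poly p}"
    and mono: "mono_on {1..} (\<lambda>j. degree (q j))" "mono_on {1..} (\<lambda>j. degree (r j))"
    using q r by (auto simp: primitive_enumeration_def)
  have "r ` {1..j} \<subseteq> q ` {1..<j}"
  proof (rule image_subsetI)
    fix i assume i: "i \<in> {1..j}"
    have "r i \<in> q ` {1..}" using bij i by (auto simp: bij_betw_def)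
    then obtain l where l: "1 \<le> l" "r i = q l" by auto
    have "degree (q l) \<le> degree (r j)" using mono_onD[OF mono(2), of i j] i j l by simp
    then have "\<not> j \<le> l" using mono_onD[OF mono(1), of j l] j l less by auto
    then show "r i \<in> q ` {1..<j}" using l by auto
  qed
  then have "card (r ` {1..j}) \<le> card (q ` {1..<j})" by (intro card_mono) auto
  also have "\<dots> \<le> card {1..<j}" by (rule card_image_le) simp
  also have "\<dots> < card {1..j}" using j by simp
  also have "\<dots> = card (r ` {1..j})"
    using bij(2) by (intro card_image[symmetric]) (auto simp: bij_betw_def intro: inj_on_subset)
  finally show False by simp
qed

text \<open>Any single enumeration serves as reference for all others; if there is none, the claim
  is vacuous. The bound is what frees the final constants from the choice of
  \<open>q\<close>.\<close>

lemma sobol_degree_bound: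
  "\<exists>E. \<forall>q. primitive_enumeration q \<longrightarrow> (\<Sum>j=1..d. degree (sobol_poly q j)) \<le> E"
proof (cases "\<exists>r. primitive_enumeration r")
  case True
  then obtain r where r: "primitive_enumeration r" by blast
  have "(\<Sum>j=1..d. degree (sobol_poly q j)) \<le> (\<Sum>j=1..d. degree (sobol_poly r j))"
    if "primitive_enumeration q" for q
    using degree_primitive_enumeration_le[OF that r] by (intro sum_mono) (auto simp: sobol_poly_def)
  then show ?thesis by blast
qed auto

lemma level_constant_pos: "0 < level_constant s"
  unfolding level_constant_def by (rule suminf_pos[OF summable_level]) simp

text \<open>Every digit position \<open>n\<close> of \<open>N\<close> is at most
  \<open>log 2 N\<close>, and there are \<open>sum_of_digits2 N\<close> of them.\<close>

lemma net_discrepancy_bound: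
  assumes s: "1 \<le> s" and N: "1 \<le> N" and net: "dyadic_net s T x"
  shows "(real N * L2_discrepancy s N x)\<^sup>2 \<le> 16 * (2 * 64 ^ s * 8 ^ T) * level_constant s *
    (real (sum_of_digits2 N) * (log 2 (real N) + 1) ^ (s - 1))"
proof -
  interpret dyadic_net s T x by (rule net)
  have l: "real n \<le> log 2 (real N)" if "bit N n" for n
  proof -
    have "2 ^ n \<le> real N" using bit_nat_bounds(1)[OF that] by (metis of_nat_le_iff of_nat_numeral of_nat_power)
    then show ?thesis using N by (simp add: le_log_iff powr_realpow)
  qed
  have "(\<Sum>n | bit N n. real (n + 1) ^ (s - 1)) \<le> (\<Sum>n | bit N n. (log 2 (real N) + 1) ^ (s - 1))"
    using l by (intro sum_mono power_mono) auto
  also have "\<dots> = real (sum_of_digits2 N) * (log 2 (real N) + 1) ^ (s - 1)"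
    by (simp add: sum_of_digits2_def)
  finally have S: "(\<Sum>n | bit N n. real (n + 1) ^ (s - 1)) \<le> real (sum_of_digits2 N) * (log 2 (real N) + 1) ^ (s - 1)" .
  have "(real N * L2_discrepancy s N x)\<^sup>2 \<le>
      16 * block_constant * level_constant s * (\<Sum>n | bit N n. real (n + 1) ^ (s - 1))"
    using N unit by (intro discrepancy_le_hat_energy sum_hat_energy_le[OF s]) auto
  also have "\<dots> \<le> 16 * block_constant * level_constant s *
      (real (sum_of_digits2 N) * (log 2 (real N) + 1) ^ (s - 1))"
    using level_constant_pos[of s] by (intro mult_left_mono[OF S]) (simp add: block_constant_def)
  finally show ?thesis by (simp only: block_constant_def)
qed

lemma sum_of_digits2_le:
  assumes "1 \<le> N"
  shows "real (sum_of_digits2 N) \<le> log 2 (real N) + 1"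
proof -
  have "{n. bit N n} \<subseteq> {..nat \<lfloor>log 2 (real N)\<rfloor>}"
  proof
    fix n assume "n \<in> {n. bit N n}"
    then have "2 ^ n \<le> N" using bit_nat_bounds(1) by blast
    then have "2 ^ n \<le> real N" by (metis of_nat_le_iff of_nat_numeral of_nat_power)
    then have "real n \<le> log 2 (real N)" using assms by (simp add: le_log_iff powr_realpow)
    then show "n \<in> {..nat \<lfloor>log 2 (real N)\<rfloor>}" by (simp add: le_nat_floor)
  qed
  then have "card {n. bit N n} \<le> card {..nat \<lfloor>log 2 (real N)\<rfloor>}" by (intro card_mono) auto
  then have "real (sum_of_digits2 N) \<le> real (nat \<lfloor>log 2 (real N)\<rfloor>) + 1"
    unfolding sum_of_digits2_def by simp
  moreover have "0 \<le> log 2 (real N)" using assms by simp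
  then have "real (nat \<lfloor>log 2 (real N)\<rfloor>) \<le> log 2 (real N)" by simp
  ultimately show ?thesis by linarith
qed

lemma log_plus_1_le:
  assumes "2 \<le> N"
  shows "log 2 (real N) + 1 \<le> 2 / ln 2 * ln (real N)"
proof -
  have "ln 2 \<le> ln (real N)" using assms by simp
  then show ?thesis by (simp add: log_def field_simps)
qed

theorem theorem1:
  fixes s :: nat
  assumes "s \<ge> 1"
  shows "\<exists>C C' :: real. C > 0 \<and> C' > 0 \<and>
    (\<forall>q. primitive_enumeration q \<longrightarrow>
      (let S = interlace_sequence 5 s (sobol_sequence (5 * s) q) in
        (\<forall>n. S n \<in> {1..s} \<rightarrow>\<^sub>E {0..<1}) \<and>
        (\<forall>N::nat. N \<ge> 2 \<longrightarrow>
          L2_discrepancy s N S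
            \<le> C * (ln (real N) powr ((real s - 1) / 2) / real N) * sqrt (real (sum_of_digits2 N)) \<and>
          C * (ln (real N) powr ((real s - 1) / 2) / real N) * sqrt (real (sum_of_digits2 N))
            \<le> C' * (ln (real N) powr (real s / 2) / real N))))"
proof -
  obtain E where E: "\<And>q. primitive_enumeration q \<Longrightarrow> (\<Sum>j=1..5 * s. degree (sobol_poly q j)) \<le> E"
    using sobol_degree_bound[of "5 * s"] by blast
  define T where "T = 25 * s + 5 * E"
  \<comment> \<open>The constant of \<open>net_discrepancy_bound\<close>, times the cost of
    replacing \<open>log 2 N + 1\<close> by a multiple of \<open>ln N\<close> in the power
    \<open>s - 1\<close>; this replacement is where \<open>N \<ge> 2\<close> is used.\<close>
  define A where "A = 16 * (2 * 64 ^ s * 8 ^ T) * level_constant s * (2 / ln 2) ^ (s - 1)"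
  define C where "C = sqrt A"
  \<comment> \<open>The extra factor comes from bounding the digit sum by
    \<open>log 2 N + 1\<close>, hence by \<open>2 / ln 2 * ln N\<close>, under the root.\<close>
  define C' where "C' = C * sqrt (2 / ln 2)"
  have A: "0 < A" using level_constant_pos[of s] by (simp add: A_def)
  then have C: "0 < C" "0 < C'" by (simp_all add: C_def C'_def)
  have range: "S n \<in> {1..s} \<rightarrow>\<^sub>E {0..<1}"
    if "primitive_enumeration q" "S = interlace_sequence 5 s (sobol_sequence (5 * s) q)" for q S n
    using interlaced_sobol_digits(1,2)[OF that(1)] unfolding that(2)
    by (auto simp: interlace_sequence_def interlace_point_def)
  have first: "L2_discrepancy s N S
      \<le> C * (ln (real N) powr ((real s - 1) / 2) / real N) * sqrt (real (sum_of_digits2 N))"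
    if q: "primitive_enumeration q" and S: "S = interlace_sequence 5 s (sobol_sequence (5 * s) q)"
      and N: "2 \<le> N" for q S N
  proof -
    define D where "D = real (sum_of_digits2 N)"
    have "dyadic_net s T S" unfolding S T_def by (rule interlaced_sobol_net[OF q E[OF q]])
    then have "(real N * L2_discrepancy s N S)\<^sup>2 \<le> 16 * (2 * 64 ^ s * 8 ^ T) * level_constant s *
        (D * (log 2 (real N) + 1) ^ (s - 1))"
      unfolding D_def using assms N by (intro net_discrepancy_bound) auto
    also have "\<dots> \<le> 16 * (2 * 64 ^ s * 8 ^ T) * level_constant s *
        (D * (2 / ln 2 * ln (real N)) ^ (s - 1))"
      using level_constant_pos[of s] log_plus_1_le[OF N] N
      by (intro mult_left_mono power_mono) (auto simp: D_def)
    also have "\<dots> = A * ln (real N) ^ (s - 1) * D"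
      unfolding A_def power_mult_distrib by (simp only: mult_ac)
    finally have "real N * L2_discrepancy s N S \<le> sqrt (A * ln (real N) ^ (s - 1) * D)"
      by (rule real_le_rsqrt)
    also have "\<dots> = C * sqrt (ln (real N) ^ (s - 1)) * sqrt D"
      by (simp add: real_sqrt_mult C_def)
    also have "sqrt (ln (real N) ^ (s - 1)) = ln (real N) powr ((real s - 1) / 2)"
      using N assms by (simp add: powr_half_sqrt[symmetric] powr_realpow[symmetric] powr_powr of_nat_diff)
    finally show ?thesis using N by (simp add: D_def field_simps)
  qed
  have second: "C * (ln (real N) powr ((real s - 1) / 2) / real N) * sqrt (real (sum_of_digits2 N))
      \<le> C' * (ln (real N) powr (real s / 2) / real N)" if N: "2 \<le> N" for N
  proof -
    have ln: "0 < ln (real N)" using N by simp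
    have "sqrt (real (sum_of_digits2 N)) \<le> sqrt (2 / ln 2 * ln (real N))"
      using sum_of_digits2_le[of N] log_plus_1_le[OF N] N by (intro real_sqrt_le_mono) linarith
    also have "\<dots> = sqrt (2 / ln 2) * ln (real N) powr (1 / 2)"
      unfolding real_sqrt_mult using ln by (simp add: powr_half_sqrt)
    finally have "C * (ln (real N) powr ((real s - 1) / 2) / real N) * sqrt (real (sum_of_digits2 N))
        \<le> C * (ln (real N) powr ((real s - 1) / 2) / real N) * (sqrt (2 / ln 2) * ln (real N) powr (1 / 2))"
      using C by (intro mult_left_mono) auto
    also have "\<dots> = C' * ((ln (real N) powr ((real s - 1) / 2) * ln (real N) powr (1 / 2)) / real N)"
      by (simp add: C'_def)
    also have "ln (real N) powr ((real s - 1) / 2) * ln (real N) powr (1 / 2) = ln (real N) powr (real s / 2)"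
      unfolding powr_add[symmetric] by (simp add: field_simps)
    finally show ?thesis .
  qed
  show ?thesis
    unfolding Let_def
    by (intro exI[of _ C] exI[of _ C'] conjI allI impI C range[OF _ refl] first[OF _ refl] second)
qed

end
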